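(* Let $k\ge 1$ be an integer. If $\mathbf{GT}_{k\lambda/k\mu,k\nu}$ is non-empty, then the lexicographically largest element $G$ of $\mathbf{GT}_{k\lambda/k\mu,k\nu}$ has no snakes in its canonical snake partition; that is, all entries of $G$ are multiples of $k$. The same holds for the lexicographically smallest element of $\mathbf{GT}_{k\lambda/k\mu,k\nu}$.
   Context: Skew GT-patterns. A skew Gelfand-Tsetlin pattern (GT-pattern) with $m$ rows of length $n$ is an array of non-negative integers $(x^i_j)_{1\le i\le m,\,1\le j\le n}$ with $x^{i+1}_j\ge x^i_j$ and $x^i_j\ge x^{i+1}_{j+1}$ whenever both entries exist. Row $i$ is $\mathbf{x}^i=(x^i_1,\dots,x^i_n)$; row $m$ is the top row and row $1$ the bottom row. For partitions $\lambda,\mu$ with at most $n$ parts (padded with zeros) and a sequence $\nu=(\nu_1,\dots,\nu_{m-1})$ of non-negative integers, $\mathbf{GT}_{\lambda/\mu,\nu}$ is the set of such patterns with top row $\lambda$, bottom row $\mu$, and $|\mathbf{x}^{i+1}|-|\mathbf{x}^i|=\nu_i$ for $1\le i\le m-1$, where $|\cdot|$ denotes the sum of entries. These correspond bijectively to semistandard tableaux of shape $\lambda/\mu$ and type $\nu$: the boxes with content $i$ are those of $\mathbf{x}^{i+1}/\mathbf{x}^i$. Multiplication by $k$ is entrywise. Lexicographic order. Patterns $G$ of the same size are compared lexicographically via the vectors $\mathbf{v}_G=(x^1_1,\dots,x^1_n,x^2_1,\dots,x^2_n,\dots,x^m_1,\dots,x^m_n)$. Tiles and snakes. The entries (positions)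 adjacent to $x^i_j$ are $x^{i+1}_j,\ x^{i+1}_{j+1},\ x^{i-1}_{j-1},\ x^{i-1}_j$ (those that exist). The tiling of $G$ is the finest partition of the entries of $G$ into tiles such that any two adjacent equal entries lie in the same tile. A tile is free if it contains no entry of the top or bottom row. A snake is a (non-empty) subset of a tile with at most one entry in each row that is connected under adjacency. Canonical snake partition of $G\in\mathbf{GT}_{k\lambda/k\mu,k\nu}$. For each free tile $T$ of $G$ whose (common) value is not divisible by $k$, let $R_1,R_2,\dots$ be the rows of $T$ from bottom to top ($R_1$ consists of the unique lowest entry of $T$) and let $R_{ij}$ be the $j$th entry from the left in $R_i$ (if it exists). For each $j$, partition the set of existing entries $R_{1j},R_{2j},R_{3j},\dots$ into connected components under adjacency; these components, for all $j$, are disjoint snakes partitioning $T$. Doing this for all such tiles $T$ gives the canonical snake partition of $G$. *)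

theory Defs
  imports Main "HOL-Library.Disjoint_Sets"
begin

section \<open>Skew Gelfand--Tsetlin patterns\<close>

text \<open>
  A pattern is the list of its rows, from the bottom row to the top row, each row being read
  from left to right. Rows and columns are counted from 0, so \<open>G ! i ! j\<close> is
  the entry usually written \<open>x\<close> with row index \<open>i + 1\<close> and column index \<open>j + 1\<close>.
\<close>

type_synonym pattern = "nat list list"

definition positions :: "pattern \<Rightarrow> (nat \<times> nat) set" where
  "positions G = {(i, j). i < length G \<and> j < length (G ! i)}"

definition entry :: "pattern \<Rightarrow> nat \<times> nat \<Rightarrow> nat" where
  "entry G = (\<lambda>(i, j). G ! i ! j)"

definition skew_GT_pattern :: "nat \<Rightarrow> nat \<Rightarrow> pattern \<Rightarrow> bool" where
  "skew_GT_pattern m n G \<longleftrightarrow>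
     length G = m \<and> (\<forall>i<m. length (G ! i) = n) \<and>
     (\<forall>i j. i + 1 < m \<and> j < n \<longrightarrow> G ! i ! j \<le> G ! (i + 1) ! j) \<and>
     (\<forall>i j. i + 1 < m \<and> j + 1 < n \<longrightarrow> G ! (i + 1) ! (j + 1) \<le> G ! i ! j)"

text \<open>A partition with at most \<open>n\<close> parts, padded with zeros.\<close>

definition padded_partition :: "nat \<Rightarrow> nat list \<Rightarrow> bool" where
  "padded_partition n lam \<longleftrightarrow> length lam = n \<and> sorted_wrt (\<ge>) lam"

definition GT :: "nat \<Rightarrow> nat \<Rightarrow> nat list \<Rightarrow> nat list \<Rightarrow> nat list \<Rightarrow> pattern set" where
  "GT m n lam mu nu =
     {G. skew_GT_pattern m n G \<and> G ! (m - 1) = lam \<and> G ! 0 = mu \<and>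
         (\<forall>i<m - 1. int (sum_list (G ! (i + 1))) - int (sum_list (G ! i)) = int (nu ! i))}"

definition scale :: "nat \<Rightarrow> nat list \<Rightarrow> nat list" where
  "scale k xs = map ((*) k) xs"


section \<open>Lexicographic order\<close>

definition lex_less :: "pattern \<Rightarrow> pattern \<Rightarrow> bool" where
  "lex_less G H \<longleftrightarrow> (concat G, concat H) \<in> lexord less_than"

definition lex_largest :: "pattern set \<Rightarrow> pattern \<Rightarrow> bool" where
  "lex_largest S G \<longleftrightarrow> G \<in> S \<and> (\<forall>H\<in>S. H \<noteq> G \<longrightarrow> lex_less H G)"

definition lex_smallest :: "pattern set \<Rightarrow> pattern \<Rightarrow> bool" where
  "lex_smallest S G \<longleftrightarrow> G \<in> S \<and> (\<forall>H\<in>S. H \<noteq> G \<longrightarrow> lex_less G H)"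


section \<open>Tiles and snakes\<close>

text \<open>The first two disjuncts are the upper neighbours of \<open>(i, j)\<close>, the last two the lower ones.\<close>

definition adjacent :: "nat \<times> nat \<Rightarrow> nat \<times> nat \<Rightarrow> bool" where
  "adjacent = (\<lambda>(i, j) (i', j').
     (i' = i + 1 \<and> j' = j) \<or> (i' = i + 1 \<and> j' = j + 1) \<or>
     (i = i' + 1 \<and> j = j' + 1) \<or> (i = i' + 1 \<and> j = j'))"

definition joins_equal_neighbours :: "pattern \<Rightarrow> (nat \<times> nat) set set \<Rightarrow> bool" where
  "joins_equal_neighbours G P \<longleftrightarrow>
     (\<forall>p\<in>positions G. \<forall>q\<in>positions G.
        adjacent p q \<and> entry G p = entry G q \<longrightarrow> (\<exists>T\<in>P. p \<in> T \<and> q \<in> T))"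

definition is_tiling :: "pattern \<Rightarrow> (nat \<times> nat) set set \<Rightarrow> bool" where
  "is_tiling G P \<longleftrightarrow>
     partition_on (positions G) P \<and> joins_equal_neighbours G P \<and>
     (\<forall>Q. partition_on (positions G) Q \<and> joins_equal_neighbours G Q
        \<longrightarrow> refines (positions G) P Q)"

text \<open>Such a finest partition exists and is unique; see \<open>is_tiling_tiling\<close> below.\<close>

definition tiling :: "pattern \<Rightarrow> (nat \<times> nat) set set" where
  "tiling G = (THE P. is_tiling G P)"

definition free_tile :: "pattern \<Rightarrow> (nat \<times> nat) set \<Rightarrow> bool" where
  "free_tile G T \<longleftrightarrow> T \<in> tiling G \<and> (\<forall>(i, j)\<in>T. i \<noteq> 0 \<and> i \<noteq> length G - 1)"

definition adj_within :: "(nat \<times> nat) set \<Rightarrow> ((nat \<times> nat) \<times> (nat \<times> nat)) set" where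
  "adj_within S = {(p, q). p \<in> S \<and> q \<in> S \<and> adjacent p q}"

definition adj_connected :: "(nat \<times> nat) set \<Rightarrow> bool" where
  "adj_connected S \<longleftrightarrow> (\<forall>p\<in>S. \<forall>q\<in>S. (p, q) \<in> (adj_within S)\<^sup>*)"

definition adj_components :: "(nat \<times> nat) set \<Rightarrow> (nat \<times> nat) set set" where
  "adj_components S = S // (adj_within S)\<^sup>*"

definition is_snake :: "pattern \<Rightarrow> (nat \<times> nat) set \<Rightarrow> bool" where
  "is_snake G S \<longleftrightarrow>
     S \<noteq> {} \<and> (\<exists>T\<in>tiling G. S \<subseteq> T) \<and>
     (\<forall>i j j'. (i, j) \<in> S \<and> (i, j') \<in> S \<longrightarrow> j = j') \<and> adj_connected S"

text \<open>
  The entries of \<open>T\<close> that are the \<open>r\<close>-th of \<open>T\<close> from the left in their row (\<open>r \<ge> 1\<close>),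
  taken over all rows of \<open>T\<close>.
\<close>

definition nth_entries :: "(nat \<times> nat) set \<Rightarrow> nat \<Rightarrow> (nat \<times> nat) set" where
  "nth_entries T r = {(i, j). (i, j) \<in> T \<and> card {j'. (i, j') \<in> T \<and> j' \<le> j} = r}"

text \<open>In the condition below, \<open>v\<close> is the common value of the entries of the tile \<open>T\<close>.\<close>

definition canonical_snake_partition :: "nat \<Rightarrow> pattern \<Rightarrow> (nat \<times> nat) set set" where
  "canonical_snake_partition k G =
     {S. \<exists>T v r. free_tile G T \<and> entry G ` T = {v} \<and> \<not> k dvd v \<and> r \<ge> 1 \<and>
         S \<in> adj_components (nth_entries T r)}"


section \<open>Well-definedness\<close>

definition equal_adj :: "pattern \<Rightarrow> ((nat \<times> nat) \<times> (nat \<times> nat)) set" where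
  "equal_adj G = {(p, q) \<in> adj_within (positions G). entry G p = entry G q}"

lemma adjacent_sym: "adjacent p q \<longleftrightarrow> adjacent q p"
  by (cases p; cases q) (auto simp: adjacent_def)

lemma sym_adj_within: "sym (adj_within S)"
  unfolding adj_within_def by (rule symI) (use adjacent_sym in blast)

lemma sym_equal_adj: "sym (equal_adj G)"
  unfolding equal_adj_def by (rule symI) (use symD[OF sym_adj_within] in fastforce)

lemma rtrancl_stays_in:
  assumes "(p, q) \<in> R\<^sup>*" "p \<in> A" "R \<subseteq> A \<times> A"
  shows "q \<in> A"
  using assms by (induction rule: rtrancl_induct) auto

lemma quotient_rtrancl_Int:
  assumes "R \<subseteq> A \<times> A"
  shows "A // R\<^sup>* = A // (R\<^sup>* \<inter> A \<times> A)"
proof -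
  have "R\<^sup>* `` {x} = (R\<^sup>* \<inter> A \<times> A) `` {x}" if "x \<in> A" for x
    using rtrancl_stays_in[OF _ that assms] that by auto
  then show ?thesis by (auto simp: quotient_def)
qed

lemma equiv_rtrancl_Int:
  assumes "sym R"
  shows "equiv A (R\<^sup>* \<inter> A \<times> A)"
proof (rule equivI)
  show "sym (R\<^sup>* \<inter> A \<times> A)"
    using sym_rtrancl[OF assms] by (auto simp: sym_def)
  show "trans (R\<^sup>* \<inter> A \<times> A)"
    using trans_rtrancl[of R] unfolding trans_def by blast
qed (auto simp: refl_on_def)

lemma is_tiling_quotient: "is_tiling G (positions G // (equal_adj G)\<^sup>*)"
proof -
  let ?A = "positions G" and ?R = "equal_adj G"
  let ?P = "?A // ?R\<^sup>*"
  have sub: "?R \<subseteq> ?A \<times> ?A"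
    by (auto simp: equal_adj_def adj_within_def)
  have part: "partition_on ?A ?P"
    unfolding quotient_rtrancl_Int[OF sub]
    by (rule partition_on_quotient[OF equiv_rtrancl_Int[OF sym_equal_adj]])
  have joins: "joins_equal_neighbours G ?P"
    unfolding joins_equal_neighbours_def
  proof (intro ballI impI)
    fix p q assume "p \<in> ?A" "q \<in> ?A" "adjacent p q \<and> entry G p = entry G q"
    then have "(p, q) \<in> ?R" by (auto simp: equal_adj_def adj_within_def)
    with \<open>p \<in> ?A\<close> show "\<exists>T\<in>?P. p \<in> T \<and> q \<in> T"
      by (intro bexI[of _ "?R\<^sup>* `` {p}"]) (auto intro: quotientI)
  qed
  have "refines ?A ?P Q" if Q: "partition_on ?A Q" "joins_equal_neighbours G Q" for Q
    unfolding refines_def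
  proof (intro conjI ballI part Q(1))
    fix X assume "X \<in> ?P"
    then obtain p where p: "p \<in> ?A" "X = ?R\<^sup>* `` {p}" by (rule quotientE)
    obtain Y where Y: "Y \<in> Q" "p \<in> Y" using p(1) partition_onD1[OF Q(1)] by blast
    have "q \<in> Y" if "(p, q) \<in> ?R\<^sup>*" for q
      using that
    proof (induction rule: rtrancl_induct)
      case base
      show ?case by (rule Y(2))
    next
      case (step q q')
      then obtain Z where "Z \<in> Q" "q \<in> Z" "q' \<in> Z"
        using Q(2) unfolding joins_equal_neighbours_def equal_adj_def adj_within_def by blast
      with step.IH Y(1) show ?case
        using partition_onD2[OF Q(1)] by (metis IntI disjointD empty_iff)
    qed
    with p(2) Y(1) show "\<exists>Y\<in>Q. X \<subseteq> Y" by blast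
  qed
  with part joins show ?thesis by (auto simp: is_tiling_def)
qed

lemma is_tiling_unique: "is_tiling G P \<Longrightarrow> is_tiling G Q \<Longrightarrow> P = Q"
  unfolding is_tiling_def by (metis refines_asym)

lemma tiling_eq_quotient: "tiling G = positions G // (equal_adj G)\<^sup>*"
  unfolding tiling_def
  by (rule the_equality, rule is_tiling_quotient) (rule is_tiling_unique[OF _ is_tiling_quotient])

lemma is_tiling_tiling: "is_tiling G (tiling G)"
  unfolding tiling_eq_quotient by (rule is_tiling_quotient)

lemma entry_tile:
  assumes "T \<in> tiling G"
  shows "\<exists>v. entry G ` T = {v}"
proof -
  obtain p where p: "T = (equal_adj G)\<^sup>* `` {p}"
    using assms unfolding tiling_eq_quotient by (rule quotientE)
  have "entry G q = entry G p" if "(p, q) \<in> (equal_adj G)\<^sup>*" for q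
    using that by (induction rule: rtrancl_induct) (auto simp: equal_adj_def)
  moreover have "p \<in> T" by (simp add: p)
  ultimately have "entry G ` T = {entry G p}" unfolding p by blast
  then show ?thesis ..
qed

lemma nth_entries_inj:
  assumes "(i, j) \<in> nth_entries T r" "(i, j') \<in> nth_entries T r"
  shows "j = j'"
proof -
  have fin: "finite {c. (i, c) \<in> T \<and> c \<le> d}" for d
    by (rule finite_subset[of _ "{..d}"]) auto
  have False if "a < b" "(i, a) \<in> nth_entries T r" "(i, b) \<in> nth_entries T r" for a b
  proof -
    have b: "b \<in> {c. (i, c) \<in> T \<and> c \<le> b}"
      and card: "card {c. (i, c) \<in> T \<and> c \<le> a} = card {c. (i, c) \<in> T \<and> c \<le> b}"
      using that(2,3) by (simp_all add: nth_entries_def)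
    have "{c. (i, c) \<in> T \<and> c \<le> a} \<subseteq> {c. (i, c) \<in> T \<and> c \<le> b}"
      using that(1) by (simp add: Collect_mono)
    from card_subset_eq[OF fin this card] b have "b \<in> {c. (i, c) \<in> T \<and> c \<le> a}" by (simp only:)
    with that(1) show False by simp
  qed
  from this[of j j'] this[of j' j] assms show ?thesis
    by (cases j j' rule: linorder_cases) auto
qed

lemma adj_components_partition: "partition_on S (adj_components S)"
proof -
  have "adj_within S \<subseteq> S \<times> S" by (auto simp: adj_within_def)
  from quotient_rtrancl_Int[OF this] show ?thesis
    unfolding adj_components_def
    using partition_on_quotient[OF equiv_rtrancl_Int[OF sym_adj_within]] by metis
qed

lemma adj_connected_component:
  assumes "C \<in> adj_components S"
  shows "adj_connected C"
proof -
  obtain p where p: "p \<in> S" "C = (adj_within S)\<^sup>* `` {p}"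
    using assms unfolding adj_components_def by (rule quotientE)
  have path: "(p, q) \<in> (adj_within C)\<^sup>*" if "(p, q) \<in> (adj_within S)\<^sup>*" for q
    using that
  proof (induction rule: rtrancl_induct)
    case (step q q')
    then have "q \<in> C" "q' \<in> C" using p(2) by auto
    with step have "(q, q') \<in> adj_within C" by (auto simp: adj_within_def)
    with step.IH show ?case by (rule rtrancl_into_rtrancl)
  qed simp
  have "(q, q') \<in> (adj_within C)\<^sup>*" if "q \<in> C" "q' \<in> C" for q q'
  proof -
    have "(q, p) \<in> (adj_within C)\<^sup>*"
      by (rule symD[OF sym_rtrancl[OF sym_adj_within]], rule path) (use that p(2) in simp)
    moreover have "(p, q') \<in> (adj_within C)\<^sup>*"
      by (rule path) (use that p(2) in simp)
    ultimately show ?thesis by (rule rtrancl_trans)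
  qed
  then show ?thesis by (auto simp: adj_connected_def)
qed

lemma canonical_snake_partition_snakes:
  assumes "S \<in> canonical_snake_partition k G"
  shows "is_snake G S"
proof -
  obtain T r where T: "T \<in> tiling G" and S: "S \<in> adj_components (nth_entries T r)"
    using assms by (auto simp: canonical_snake_partition_def free_tile_def)
  have sub: "S \<subseteq> nth_entries T r" "S \<noteq> {}"
    using S adj_components_partition[of "nth_entries T r"] by (auto simp: partition_on_def)
  have "nth_entries T r \<subseteq> T" by (auto simp: nth_entries_def)
  show ?thesis
    unfolding is_snake_def
  proof (intro conjI allI impI)
    show "j = j'" if "(i, j) \<in> S \<and> (i, j') \<in> S" for i j j'
      using that sub(1) by (intro nth_entries_inj[of i j T r j']) auto
    show "\<exists>T\<in>tiling G. S \<subseteq> T"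
      using T sub(1) \<open>nth_entries T r \<subseteq> T\<close> by blast
  qed (rule sub(2), rule adj_connected_component[OF S])
qed

end

theory Submission
  imports Defs
begin

text \<open>
  A row of a pattern is a partition, so it may be replaced by its conjugate: column \<open>t\<close> has as
  height the number of entries of the row that exceed \<open>t\<close>. The interlacing conditions then say
  that from one row to the next each column grows by 0 or 1, and the size of the row is the sum of
  its column heights. Recovering a row from its column heights sorts them, so the columns may be
  changed independently of each other: any family of columns with steps 0 or 1 gives a pattern.

  For a pattern \<open>G\<close> whose top and bottom rows are \<open>k\<lambda>\<close> and \<open>k\<mu>\<close>, group the columns into blocks
  of \<open>k\<close> consecutive ones. All columns of block \<open>q\<close> start at the height of column \<open>q\<close> of \<open>\<mu>\<close> and
  end at the height of column \<open>q\<close> of \<open>\<lambda>\<close>. Taking one column from each block gives a \<^emph>\<open>layer\<close>, which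
  is a pattern from \<open>\<mu>\<close> to \<open>\<lambda>\<close>; there are \<open>k\<close> layers, and the only defect is that a layer may have
  the wrong number of growing columns at a given step, while the average over the layers is
  \<open>\<nu>\<close>. A layer is a bipartite graph between blocks and steps. Two layers can be rebalanced by an
  equitable two-colouring of their symmetric difference, and repeating this repairs the defect
  without changing the total number of columns of a block that grow at a step
  (\<open>balanced_layers\<close>).

  Now let \<open>r\<close> be the lowest row of \<open>G\<close> that contains an entry not divisible by \<open>k\<close>. Below \<open>r\<close>, the
  columns of a block agree, so that rebalancing changes nothing there, and hence in row \<open>r\<close> the
  multiset of column heights of all layers together is still that of \<open>G\<close>. So \<open>G\<close> is the sum of the
  \<open>k\<close> repaired layers \<open>P\<close> in row \<open>r\<close>, and equals \<open>k P\<close> below it (\<open>GT_layers\<close>). In other words, up to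
  row \<open>r\<close> the pattern \<open>G\<close> is the average of the patterns \<open>k P\<close>, which have the same boundary and
  weight as \<open>G\<close>. They cannot all agree with \<open>G\<close> in row \<open>r\<close>, since their entries are multiples of
  \<open>k\<close>. At the first position where some of them differs from \<open>G\<close>, one is larger and another one is
  smaller than the average, so \<open>G\<close> is neither the largest nor the smallest pattern
  (\<open>not_multiple_not_lex_extremal\<close>). A pattern all of whose entries are multiples of \<open>k\<close> has an
  empty canonical snake partition by definition.
\<close>

section \<open>Equitable two-colourings of bipartite graphs\<close>

text \<open>
  Pairing off elements inside each fibre of \<open>g\<close> until at most one is left. The pairing is encoded as
  an involution, the leftover elements being its fixed points.
\<close>

lemma ex_pairing:
  fixes g :: "'a \<Rightarrow> 'b"
  assumes "finite E"
  shows "\<exists>p. (\<forall>x\<in>E. p x \<in> E \<and> p (p x) = x \<and> g (p x) = g x) \<and>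
    (\<forall>x\<in>E. \<forall>y\<in>E. p x = x \<longrightarrow> p y = y \<longrightarrow> g x = g y \<longrightarrow> x = y)"
  using assms
proof (induction rule: finite_psubset_induct)
  case (psubset E)
  show ?case
  proof (cases "inj_on g E")
    case True
    then show ?thesis by (intro exI[of _ id]) (auto simp: inj_on_def)
  next
    case False
    then obtain x y where xy: "x \<in> E" "y \<in> E" "x \<noteq> y" "g x = g y"
      by (auto simp: inj_on_def)
    have "E - {x, y} \<subset> E" using xy by blast
    from psubset.IH[OF this] obtain p where p:
      "\<forall>z\<in>E - {x, y}. p z \<in> E - {x, y} \<and> p (p z) = z \<and> g (p z) = g z"
      "\<forall>z\<in>E - {x, y}. \<forall>w\<in>E - {x, y}. p z = z \<longrightarrow> p w = w \<longrightarrow> g z = g w \<longrightarrow> z = w"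
      by blast
    define p' where "p' = p(x := y, y := x)"
    have p': "p' x = y" "p' y = x" "\<And>z. z \<noteq> x \<Longrightarrow> z \<noteq> y \<Longrightarrow> p' z = p z"
      using xy(3) by (auto simp: p'_def)
    have "p' z \<in> E \<and> p' (p' z) = z \<and> g (p' z) = g z" if "z \<in> E" for z
    proof (cases "z = x \<or> z = y")
      case True
      then show ?thesis using xy p' by auto
    next
      case False
      with that p(1) have "p z \<in> E - {x, y}" "p (p z) = z" "g (p z) = g z" by auto
      with False p' show ?thesis by auto
    qed
    moreover have "z = w" if "z \<in> E" "w \<in> E" "p' z = z" "p' w = w" "g z = g w" for z w
    proof -
      have zw: "z \<noteq> x" "z \<noteq> y" "w \<noteq> x" "w \<noteq> y" using that(3,4) p'(1,2) xy(3) by metis+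
      then have "p z = z" "p w = w" using that(3,4) p'(3) by metis+
      then show ?thesis using p(2) zw that(1,2,5) by blast
    qed
    ultimately show ?thesis by blast
  qed
qed

text \<open>
  The union of two matchings has only paths and even cycles as components, so it is bipartite. The
  induction avoids talking about components: delete an edge \<open>{x, p x}\<close> of one matching and join
  the partners of its two ends in the other matching, so that the colours of these partners differ
  and the deleted ends can be coloured between them.
\<close>

lemma two_colouring:
  fixes p q :: "'a \<Rightarrow> 'a"
  assumes "finite E"
    and "\<forall>x\<in>E. p x \<in> E \<and> p (p x) = x" and "\<forall>x\<in>E. q x \<in> E \<and> q (q x) = x"
  shows "\<exists>f. \<forall>x\<in>E. (p x \<noteq> x \<longrightarrow> f (p x) = (\<not> f x)) \<and> (q x \<noteq> x \<longrightarrow> f (q x) = (\<not> f x))"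
  using assms
proof (induction arbitrary: p q rule: finite_psubset_induct)
  case (psubset E)
  have contract: "\<exists>f. \<forall>z\<in>E. (p z \<noteq> z \<longrightarrow> f (p z) = (\<not> f z)) \<and> (q z \<noteq> z \<longrightarrow> f (q z) = (\<not> f z))"
    if p: "\<forall>x\<in>E. p x \<in> E \<and> p (p x) = x" and q: "\<forall>x\<in>E. q x \<in> E \<and> q (q x) = x"
      and x: "x \<in> E" "p x \<noteq> x" for p q x
  proof -
    define y where "y = p x"
    have y: "y \<in> E" "y \<noteq> x" "p y = x" using p x by (auto simp: y_def)
    \<comment> \<open>the second matching with the ends \<open>x\<close> and \<open>y\<close> removed and their partners joined\<close>
    define q' where "q' z = (if z = q x then (if q y = y then z else q y)
        else if z = q y then (if q x = x then z else q x) else q z)" for z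
    have "\<forall>z\<in>E - {x, y}. p z \<in> E - {x, y} \<and> p (p z) = z"
    proof
      fix z assume z: "z \<in> E - {x, y}"
      then have "p z \<in> E" "p (p z) = z" using p by auto
      moreover have "p z \<noteq> x" "p z \<noteq> y" using \<open>p (p z) = z\<close> z y y_def by auto
      ultimately show "p z \<in> E - {x, y} \<and> p (p z) = z" by blast
    qed
    moreover have "\<forall>z\<in>E - {x, y}. q' z \<in> E - {x, y} \<and> q' (q' z) = z"
    proof
      fix z assume z: "z \<in> E - {x, y}"
      have q_at: "q x \<in> E" "q (q x) = x" "q y \<in> E" "q (q y) = y" "q z \<in> E" "q (q z) = z"
        using q x(1) y(1) z by auto
      consider "z = q x" | "z \<noteq> q x" "z = q y" | "z \<noteq> q x" "z \<noteq> q y" by blast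
      then show "q' z \<in> E - {x, y} \<and> q' (q' z) = z"
      proof cases
        case 1
        then have "q x \<noteq> x" "q x \<noteq> y" "q y \<noteq> x" "q y \<noteq> q x"
          using z q_at y(2) by auto
        with 1 q_at show ?thesis by (auto simp: q'_def)
      next
        case 2
        then have "q y \<noteq> y" "q y \<noteq> x" "q x \<noteq> y" using z q_at by auto
        with 2 q_at show ?thesis by (auto simp: q'_def)
      next
        case 3
        then have "q z \<noteq> x" "q z \<noteq> y" using q_at by auto
        moreover have "q z \<noteq> q x" "q z \<noteq> q y" using q_at z by (metis DiffE insertI1, metis DiffE insertI1 insertI2)
        ultimately show ?thesis using 3 q_at by (simp add: q'_def)
      qed
    qed
    ultimately obtain f' where f': "\<forall>z\<in>E - {x, y}.
        (p z \<noteq> z \<longrightarrow> f' (p z) = (\<not> f' z)) \<and> (q' z \<noteq> z \<longrightarrow> f' (q' z) = (\<not> f' z))"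
      using psubset.IH[of "E - {x, y}" p q'] x(1) by blast
    \<comment> \<open>the colour of \<open>x\<close> is forced by the partner of \<open>x\<close> or else by that of \<open>y\<close>; if both exist, the
      joining edge makes the two requirements agree\<close>
    define c where "c = (if q x \<noteq> x \<and> q x \<noteq> y then \<not> f' (q x)
        else if q y \<noteq> y \<and> q y \<noteq> x then f' (q y) else True)"
    define f where "f = f'(x := c, y := \<not> c)"
    have "(p z \<noteq> z \<longrightarrow> f (p z) = (\<not> f z)) \<and> (q z \<noteq> z \<longrightarrow> f (q z) = (\<not> f z))" if z: "z \<in> E" for z
    proof
      show "p z \<noteq> z \<longrightarrow> f (p z) = (\<not> f z)"
      proof (cases "z = x \<or> z = y")
        case True
        then show ?thesis using y y_def by (auto simp: f_def)
      next
        case False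
        then have "p z \<noteq> x" "p z \<noteq> y" using p z y y_def by auto
        then show ?thesis using bspec[OF f', of z] z False by (simp add: f_def)
      qed
      have qx: "q x \<in> E" "q (q x) = x" "q y \<in> E" "q (q y) = y" "q z \<in> E" "q (q z) = z"
        using q x(1) y(1) z by auto
      consider "z = x" | "z = y" | "z = q x" "z \<noteq> x" "z \<noteq> y" | "z = q y" "z \<noteq> x" "z \<noteq> y"
        | "z \<in> E - {x, y}" "z \<noteq> q x" "z \<noteq> q y" using z by blast
      then show "q z \<noteq> z \<longrightarrow> f (q z) = (\<not> f z)"
      proof cases
        case 5
        then have "q' z = q z" "q z \<noteq> x" "q z \<noteq> y" using qx by (auto simp: q'_def)
        then show ?thesis using bspec[OF f' 5(1)] 5(1) by (simp add: f_def)
      next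
        case 1
        then show ?thesis using y by (auto simp: f_def c_def)
      next
        case 3
        then show ?thesis using y qx by (auto simp: f_def c_def)
      next
        case 2
        have "f' (q y) = (\<not> f' (q x))" if "q x \<noteq> x" "q x \<noteq> y" "q y \<noteq> x" "q y \<noteq> y"
        proof -
          have "q' (q x) = q y" "q y \<noteq> q x" "q x \<in> E - {x, y}"
            using that qx y(2) by (auto simp: q'_def)
          then show ?thesis using f' by metis
        qed
        then show ?thesis using 2 y qx by (auto simp: f_def c_def)
      next
        case 4
        have "f' (q y) = (\<not> f' (q x))" if "q x \<noteq> x" "q x \<noteq> y"
        proof -
          have "q' (q x) = q y" "q y \<noteq> q x" "q x \<in> E - {x, y}"
            using that 4 qx y(2) by (auto simp: q'_def)
          then show ?thesis using f' by metis
        qed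
        then show ?thesis using 4 y qx by (auto simp: f_def c_def)
      qed
    qed
    then show ?thesis by blast
  qed
  show ?case
  proof (cases "\<exists>x\<in>E. p x \<noteq> x")
    case True
    then obtain x where "x \<in> E" "p x \<noteq> x" by blast
    from contract[OF psubset.prems this] show ?thesis .
  next
    case False
    show ?thesis
    proof (cases "\<exists>x\<in>E. q x \<noteq> x")
      case True
      then obtain x where "x \<in> E" "q x \<noteq> x" by blast
      from contract[OF psubset.prems(2,1) this] show ?thesis by (simp only: conj_commute)
    next
      case q: False
      show ?thesis by (rule exI[of _ "\<lambda>_. True"]) (use False q in simp)
    qed
  qed
qed

lemma colour_classes_balanced:
  assumes fin: "finite E"
    and p: "\<forall>x\<in>E. p x \<in> E \<and> p (p x) = x \<and> g (p x) = g x"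
    and fixed: "\<forall>x\<in>E. \<forall>y\<in>E. p x = x \<longrightarrow> p y = y \<longrightarrow> g x = g y \<longrightarrow> x = y"
    and f: "\<forall>x\<in>E. p x \<noteq> x \<longrightarrow> f (p x) = (\<not> f x)"
  shows "card {x \<in> E. f x \<and> g x = v} \<le> card {x \<in> E. \<not> f x \<and> g x = v} + 1"
proof -
  let ?A = "{x \<in> E. f x \<and> g x = v}" and ?B = "{x \<in> E. \<not> f x \<and> g x = v}"
  let ?M = "{x \<in> ?A. p x \<noteq> x}" and ?F = "{x \<in> ?A. p x = x}"
  have "card ?M = card (p ` ?M)"
    using p by (intro card_image[symmetric] inj_onI) (metis (no_types, lifting) mem_Collect_eq)
  also have "\<dots> \<le> card ?B" using fin p f by (intro card_mono) auto
  finally have "card ?M \<le> card ?B" .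
  moreover have "card ?F \<le> 1" using fin fixed by (auto simp: card_le_Suc0_iff_eq)
  moreover have "card ?A = card ?M + card ?F"
    using fin by (subst card_Un_disjoint[symmetric]) (auto intro: arg_cong[where f=card])
  ultimately show ?thesis by simp
qed

text \<open>
  The edges of a bipartite graph, with end points \<open>a e\<close> and \<open>b e\<close>, can be split into two parts that
  are balanced at every vertex. Pair the edges at each left vertex and, independently, at each right
  vertex; a colouring that separates all pairs leaves an imbalance only from the unpaired edge, of which
  each vertex has at most one.
\<close>

lemma equitable_bipartition:
  fixes a :: "'e \<Rightarrow> 'a" and b :: "'e \<Rightarrow> 'b"
  assumes fin: "finite E"
  shows "\<exists>F\<subseteq>E.
    (\<forall>v. card {x \<in> F. a x = v} \<le> card {x \<in> E - F. a x = v} + 1 \<and>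
         card {x \<in> E - F. a x = v} \<le> card {x \<in> F. a x = v} + 1) \<and>
    (\<forall>v. card {x \<in> F. b x = v} \<le> card {x \<in> E - F. b x = v} + 1 \<and>
         card {x \<in> E - F. b x = v} \<le> card {x \<in> F. b x = v} + 1)"
proof -
  obtain p where p: "\<forall>x\<in>E. p x \<in> E \<and> p (p x) = x \<and> a (p x) = a x"
    "\<forall>x\<in>E. \<forall>y\<in>E. p x = x \<longrightarrow> p y = y \<longrightarrow> a x = a y \<longrightarrow> x = y"
    using ex_pairing[OF fin, of a] by blast
  obtain q where q: "\<forall>x\<in>E. q x \<in> E \<and> q (q x) = x \<and> b (q x) = b x"
    "\<forall>x\<in>E. \<forall>y\<in>E. q x = x \<longrightarrow> q y = y \<longrightarrow> b x = b y \<longrightarrow> x = y"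
    using ex_pairing[OF fin, of b] by blast
  have inv: "\<forall>x\<in>E. p x \<in> E \<and> p (p x) = x" "\<forall>x\<in>E. q x \<in> E \<and> q (q x) = x"
    using p(1) q(1) by simp_all
  obtain f where "\<forall>x\<in>E. (p x \<noteq> x \<longrightarrow> f (p x) = (\<not> f x)) \<and> (q x \<noteq> x \<longrightarrow> f (q x) = (\<not> f x))"
    using two_colouring[OF fin inv] by (elim exE)
  then have f: "\<forall>x\<in>E. p x \<noteq> x \<longrightarrow> f (p x) = (\<not> f x)" "\<forall>x\<in>E. q x \<noteq> x \<longrightarrow> f (q x) = (\<not> f x)"
    by simp_all
  then have f': "\<forall>x\<in>E. p x \<noteq> x \<longrightarrow> (\<not> f (p x)) = (\<not> \<not> f x)"
    "\<forall>x\<in>E. q x \<noteq> x \<longrightarrow> (\<not> f (q x)) = (\<not> \<not> f x)"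
    by simp_all
  have F: "{x \<in> {x \<in> E. f x}. P x} = {x \<in> E. f x \<and> P x}"
    "{x \<in> E - {x \<in> E. f x}. P x} = {x \<in> E. \<not> f x \<and> P x}" for P by auto
  note bal = colour_classes_balanced[OF fin p f(1)] colour_classes_balanced[OF fin q f(2)]
    colour_classes_balanced[OF fin p, of "\<lambda>x. \<not> f x", OF f'(1)]
    colour_classes_balanced[OF fin q, of "\<lambda>x. \<not> f x", OF f'(2)]
  show ?thesis
    by (intro exI[of _ "{x \<in> E. f x}"], unfold F) (use bal in auto)
qed

lemma sum_two_changed:
  fixes f g :: "'a \<Rightarrow> 'b::comm_monoid_add"
  assumes "finite A" "s \<in> A" "t \<in> A" "s \<noteq> t" "\<And>u. u \<in> A \<Longrightarrow> u \<noteq> s \<Longrightarrow> u \<noteq> t \<Longrightarrow> g u = f u"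
  shows "sum g A + (f s + f t) = sum f A + (g s + g t)"
proof -
  have split: "sum e A = e s + (e t + sum e (A - {s, t}))" for e :: "'a \<Rightarrow> 'b"
  proof -
    have "sum e A = e s + sum e (A - {s})" using assms by (intro sum.remove)
    also have "sum e (A - {s}) = e t + sum e (A - {s} - {t})" using assms by (intro sum.remove) auto
    also have "A - {s} - {t} = A - {s, t}" by blast
    finally show ?thesis .
  qed
  have "sum g (A - {s, t}) = sum f (A - {s, t})"
    by (rule sum.cong[OF refl]) (use assms(5) in blast)
  then show ?thesis by (simp only: split[of f] split[of g] ac_simps)
qed

section \<open>Balancing layers\<close>

text \<open>
  A bipartite graph with left vertices below \<open>Q\<close> is given by its neighbourhoods \<open>X q\<close>; this is the
  degree of a right vertex.
\<close>

definition degree :: "nat \<Rightarrow> (nat \<Rightarrow> nat set) \<Rightarrow> nat \<Rightarrow> nat" where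
  "degree Q X i = card {q. q < Q \<and> i \<in> X q}"

lemma degree_eq_sum: "degree Q X i = (\<Sum>q<Q. of_bool (i \<in> X q))"
  by (simp add: degree_def Int_def)

text \<open>
  Edges common to both graphs are kept, and the symmetric difference is split equitably. At a left
  vertex the symmetric difference has even degree, because \<open>X\<close> and \<open>Y\<close> have equal degrees there,
  and so an imbalance of at most 1 is no imbalance at all.
\<close>

lemma balance_two_layers:
  fixes X Y :: "nat \<Rightarrow> nat set"
  assumes fin: "\<And>q. q < Q \<Longrightarrow> finite (X q) \<and> finite (Y q)"
    and card: "\<And>q. q < Q \<Longrightarrow> card (X q) = card (Y q)"
  obtains X' Y' where
    "\<And>q. q < Q \<Longrightarrow> X' q \<union> Y' q = X q \<union> Y q" "\<And>q. q < Q \<Longrightarrow> X' q \<inter> Y' q = X q \<inter> Y q"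
    "\<And>q. q < Q \<Longrightarrow> card (X' q) = card (X q)" "\<And>q. q < Q \<Longrightarrow> card (Y' q) = card (X q)"
    "\<And>i. degree Q X' i \<le> degree Q Y' i + 1" "\<And>i. degree Q Y' i \<le> degree Q X' i + 1"
proof -
  define E where "E = (SIGMA q:{..<Q}. (X q - Y q) \<union> (Y q - X q))"
  have finE: "finite E" using fin by (auto simp: E_def)
  obtain F where F: "F \<subseteq> E"
    and row: "\<And>q. card {x \<in> F. fst x = q} \<le> card {x \<in> E - F. fst x = q} + 1"
      "\<And>q. card {x \<in> E - F. fst x = q} \<le> card {x \<in> F. fst x = q} + 1"
    and col: "\<And>i. card {x \<in> F. snd x = i} \<le> card {x \<in> E - F. snd x = i} + 1"
      "\<And>i. card {x \<in> E - F. snd x = i} \<le> card {x \<in> F. snd x = i} + 1"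
    using equitable_bipartition[OF finE, of fst snd] by (elim exE conjE) simp
  define X' where "X' q = (X q \<inter> Y q) \<union> {i. (q, i) \<in> F}" for q
  define Y' where "Y' q = (X q \<inter> Y q) \<union> {i. (q, i) \<in> E - F}" for q
  have un: "X' q \<union> Y' q = X q \<union> Y q" if "q < Q" for q
    using F that by (auto simp: X'_def Y'_def E_def)
  have int: "X' q \<inter> Y' q = X q \<inter> Y q" if "q < Q" for q
    using F that by (auto simp: X'_def Y'_def E_def)
  have row_card: "card {x \<in> A. fst x = q} = card {i. (q, i) \<in> A}" for A :: "(nat \<times> nat) set" and q
    by (rule bij_betw_same_card[of snd]) (force simp: bij_betw_def inj_on_def)
  have col_card: "card {x \<in> A. snd x = i} = card {q. (q, i) \<in> A}" for A :: "(nat \<times> nat) set" and i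
    by (rule bij_betw_same_card[of fst]) (force simp: bij_betw_def inj_on_def)
  have cards: "card (X' q) = card (X q) \<and> card (Y' q) = card (X q)" if q: "q < Q" for q
  proof -
    have fin': "finite (X q)" "finite (Y q)" using fin q by auto
    have f1: "finite {i. (q, i) \<in> F}" "finite {i. (q, i) \<in> E - F}"
      by (rule finite_subset[of _ "snd ` E"], use F finE in force, use finE in blast)+
    have cX: "card (X' q) = card (X q \<inter> Y q) + card {i. (q, i) \<in> F}"
      unfolding X'_def by (rule card_Un_disjoint) (use fin' f1 F in \<open>auto simp: E_def\<close>)
    have cY: "card (Y' q) = card (X q \<inter> Y q) + card {i. (q, i) \<in> E - F}"
      unfolding Y'_def by (rule card_Un_disjoint) (use fin' f1 F in \<open>auto simp: E_def\<close>)
    have fin2: "finite (X' q)" "finite (Y' q)" using un[OF q] fin' by (metis finite_Un)+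
    have "card (X' q) + card (Y' q) = card (X q) + card (Y q)"
      using card_Un_Int[OF fin2] card_Un_Int[OF fin'] un[OF q] int[OF q] by simp
    moreover have "card (X' q) \<le> card (Y' q) + 1" "card (Y' q) \<le> card (X' q) + 1"
      using row[of q, unfolded row_card] cX cY by linarith+
    ultimately show ?thesis using card[OF q] by linarith
  qed
  have degX: "degree Q X' i = card {q. q < Q \<and> i \<in> X q \<inter> Y q} + card {q. (q, i) \<in> F}" for i
    unfolding degree_def X'_def
    by (subst card_Un_disjoint[symmetric])
      (use F in \<open>auto simp: E_def intro!: arg_cong[where f=card] intro: finite_subset[of _ "{..<Q}"]\<close>)
  have degY: "degree Q Y' i = card {q. q < Q \<and> i \<in> X q \<inter> Y q} + card {q. (q, i) \<in> E - F}" for i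
    unfolding degree_def Y'_def
    by (subst card_Un_disjoint[symmetric])
      (use F in \<open>auto simp: E_def intro!: arg_cong[where f=card] intro: finite_subset[of _ "{..<Q}"]\<close>)
  have "degree Q X' i \<le> degree Q Y' i + 1" "degree Q Y' i \<le> degree Q X' i + 1" for i
    using col[of i, unfolded col_card] degX[of i] degY[of i] by linarith+
  with un int cards show thesis by (intro that[of X' Y']) simp_all
qed

text \<open>
  Two numbers with given sum have the least sum of squares when they are as close as possible. This
  makes rebalancing decrease the energy used below.
\<close>

lemma sum_squares_of_near:
  fixes x y a b :: nat
  assumes "x + y = a + b" "x \<le> y + 1" "y \<le> x + 1"
  shows "x\<^sup>2 + y\<^sup>2 \<le> a\<^sup>2 + b\<^sup>2 \<and> (\<not> a \<le> b + 1 \<longrightarrow> x\<^sup>2 + y\<^sup>2 < a\<^sup>2 + b\<^sup>2)"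
proof -
  define X Y A B where "X = int x" and "Y = int y" and "A = int a" and "B = int b"
  note defs = X_def Y_def A_def B_def
  have XY: "X + Y = A + B" "\<bar>X - Y\<bar> \<le> 1" using assms by (simp_all add: defs)
  have "(X + Y) * (X + Y) = (A + B) * (A + B)" using XY(1) by simp
  then have split: "2 * (A\<^sup>2 + B\<^sup>2) - 2 * (X\<^sup>2 + Y\<^sup>2) = (A - B)\<^sup>2 - (X - Y)\<^sup>2"
    by (simp add: power2_eq_square algebra_simps)
  have "even (A - B) \<longleftrightarrow> even (X - Y)" using XY(1) by presburger
  then have "\<bar>X - Y\<bar> \<le> \<bar>A - B\<bar>" using XY(2) by presburger
  then have "(X - Y)\<^sup>2 \<le> (A - B)\<^sup>2" by (simp only: abs_le_square_iff)
  moreover have "(X - Y)\<^sup>2 < (A - B)\<^sup>2" if "\<not> a \<le> b + 1"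
  proof -
    have "\<not> \<bar>A - B\<bar> \<le> \<bar>X - Y\<bar>" using that XY(2) by (simp add: A_def B_def)
    then show ?thesis by (simp only: abs_le_square_iff not_le)
  qed
  moreover have "int (x\<^sup>2 + y\<^sup>2) = X\<^sup>2 + Y\<^sup>2" "int (a\<^sup>2 + b\<^sup>2) = A\<^sup>2 + B\<^sup>2"
    by (simp_all add: defs)
  ultimately have "X\<^sup>2 + Y\<^sup>2 \<le> A\<^sup>2 + B\<^sup>2"
    and "\<not> a \<le> b + 1 \<longrightarrow> X\<^sup>2 + Y\<^sup>2 < A\<^sup>2 + B\<^sup>2"
    and int: "X\<^sup>2 + Y\<^sup>2 = int (x\<^sup>2 + y\<^sup>2)" "A\<^sup>2 + B\<^sup>2 = int (a\<^sup>2 + b\<^sup>2)"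
    using split by auto
  then show ?thesis unfolding int by (simp only: of_nat_le_iff of_nat_less_iff simp_thms)
qed

text \<open>
  Among all ways of distributing the edges over the layers with the prescribed left degrees and edge
  multiplicities, take one that minimizes the sum of the squares of the right degrees. By
  \<open>balance_two_layers\<close>, the degrees of a right vertex in any two layers then differ by at most 1, and
  as their average over the \<open>k\<close> layers is the integer \<open>d i\<close>, they all equal \<open>d i\<close>.
\<close>

lemma balanced_layers:
  fixes S :: "nat \<Rightarrow> nat \<Rightarrow> nat set" and h d :: "nat \<Rightarrow> nat"
  assumes S: "\<And>s q. s < k \<Longrightarrow> q < Q \<Longrightarrow> S s q \<subseteq> {..<r} \<and> card (S s q) = h q"
    and deg: "\<And>i. i < r \<Longrightarrow> (\<Sum>s<k. degree Q (S s) i) = k * d i"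
  obtains L where
    "\<And>s q. s < k \<Longrightarrow> q < Q \<Longrightarrow> L s q \<subseteq> {..<r} \<and> card (L s q) = h q"
    "\<And>q i. q < Q \<Longrightarrow> (\<Sum>s<k. of_bool (i \<in> L s q)) = (\<Sum>s<k. of_bool (i \<in> S s q) :: nat)"
    "\<And>s i. s < k \<Longrightarrow> i < r \<Longrightarrow> degree Q (L s) i = d i"
proof -
  define C where "C = (\<lambda>L. (\<forall>s<k. \<forall>q<Q. L s q \<subseteq> {..<r} \<and> card (L s q) = h q) \<and>
      (\<forall>q<Q. \<forall>i. (\<Sum>s<k. of_bool (i \<in> L s q)) = (\<Sum>s<k. of_bool (i \<in> S s q) :: nat)))"
  define energy where "energy = (\<lambda>L. \<Sum>i<r. \<Sum>s<k. (degree Q (L s) i)\<^sup>2)"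
  have "C S" using S by (simp add: C_def)
  then obtain L where L: "C L" and min: "\<And>L'. C L' \<Longrightarrow> energy L \<le> energy L'"
    using ex_has_least_nat[of C S energy] by blast
  have L1: "L s q \<subseteq> {..<r}" "card (L s q) = h q" if "s < k" "q < Q" for s q
    using L that by (simp_all add: C_def)
  have L2: "(\<Sum>s<k. of_bool (i \<in> L s q)) = (\<Sum>s<k. of_bool (i \<in> S s q) :: nat)" if "q < Q" for q i
    using L that unfolding C_def by blast
  have total: "(\<Sum>s<k. degree Q (L s) i) = k * d i" if "i < r" for i
  proof -
    have "(\<Sum>s<k. degree Q (L s) i) = (\<Sum>q<Q. \<Sum>s<k. of_bool (i \<in> L s q))"
      unfolding degree_eq_sum by (rule sum.swap)
    also have "\<dots> = (\<Sum>q<Q. \<Sum>s<k. of_bool (i \<in> S s q))"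
      by (rule sum.cong[OF refl], rule L2) simp
    also have "\<dots> = (\<Sum>s<k. degree Q (S s) i)"
      unfolding degree_eq_sum by (rule sum.swap)
    finally show ?thesis using deg[OF that] by simp
  qed
  have near: "degree Q (L s) i \<le> degree Q (L t) i + 1" if st: "s < k" "t < k" and i: "i < r" for s t i
  proof (rule ccontr)
    assume far: "\<not> degree Q (L s) i \<le> degree Q (L t) i + 1"
    then have neq: "s \<noteq> t" by auto
    have Lst: "L s q \<subseteq> {..<r}" "L t q \<subseteq> {..<r}" "card (L s q) = h q" "card (L t q) = h q" if "q < Q" for q
      using L1 st that by auto
    have "\<And>q. q < Q \<Longrightarrow> finite (L s q) \<and> finite (L t q)"
      using Lst by (meson finite_lessThan finite_subset)
    moreover have "\<And>q. q < Q \<Longrightarrow> card (L s q) = card (L t q)" using Lst by simp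
    ultimately obtain X Y where XY:
      "\<And>q. q < Q \<Longrightarrow> X q \<union> Y q = L s q \<union> L t q" "\<And>q. q < Q \<Longrightarrow> X q \<inter> Y q = L s q \<inter> L t q"
      "\<And>q. q < Q \<Longrightarrow> card (X q) = card (L s q)" "\<And>q. q < Q \<Longrightarrow> card (Y q) = card (L s q)"
      "\<And>i. degree Q X i \<le> degree Q Y i + 1" "\<And>i. degree Q Y i \<le> degree Q X i + 1"
      using balance_two_layers[of Q "L s" "L t"] by metis
    define L' where "L' = L(s := X, t := Y)"
    have L': "L' s = X" "L' t = Y" "\<And>u. u \<noteq> s \<Longrightarrow> u \<noteq> t \<Longrightarrow> L' u = L u"
      using neq by (auto simp: L'_def)
    have pair: "of_bool (j \<in> X q) + of_bool (j \<in> Y q) = (of_bool (j \<in> L s q) + of_bool (j \<in> L t q) :: nat)"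
      if "q < Q" for j q
      using XY(1,2)[OF that] by (auto simp: of_bool_def set_eq_iff split: if_splits)
    have "C L'"
      unfolding C_def
    proof (intro conjI allI impI)
      fix u q assume "u < k" "q < Q"
      show "L' u q \<subseteq> {..<r}" "card (L' u q) = h q"
        using L1[OF \<open>u < k\<close> \<open>q < Q\<close>] XY(1,3,4)[OF \<open>q < Q\<close>] Lst[OF \<open>q < Q\<close>]
        unfolding L'_def by auto
    next
      fix q j assume q: "q < Q"
      have "(\<Sum>u<k. of_bool (j \<in> L' u q)) + (of_bool (j \<in> L s q) + of_bool (j \<in> L t q)) =
          (\<Sum>u<k. of_bool (j \<in> L u q) :: nat) + (of_bool (j \<in> L' s q) + of_bool (j \<in> L' t q))"
        by (rule sum_two_changed) (use st neq L' in auto)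
      then show "(\<Sum>u<k. of_bool (j \<in> L' u q)) = (\<Sum>u<k. of_bool (j \<in> S u q) :: nat)"
        using L2[OF q, of j] pair[OF q, of j] unfolding L' by linarith
    qed
    have energy_at: "(\<Sum>u<k. (degree Q (L' u) j)\<^sup>2) \<le> (\<Sum>u<k. (degree Q (L u) j)\<^sup>2) \<and>
        (j = i \<longrightarrow> (\<Sum>u<k. (degree Q (L' u) j)\<^sup>2) < (\<Sum>u<k. (degree Q (L u) j)\<^sup>2))" for j
    proof -
      have R: "(\<Sum>u<k. (degree Q (L' u) j)\<^sup>2) + ((degree Q (L s) j)\<^sup>2 + (degree Q (L t) j)\<^sup>2) =
          (\<Sum>u<k. (degree Q (L u) j)\<^sup>2) + ((degree Q (L' s) j)\<^sup>2 + (degree Q (L' t) j)\<^sup>2)"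
        by (rule sum_two_changed) (use st neq L' in auto)
      have eq: "degree Q X j + degree Q Y j = degree Q (L s) j + degree Q (L t) j"
        unfolding degree_eq_sum sum.distrib[symmetric] by (intro sum.cong) (use pair in auto)
      show ?thesis
        using sum_squares_of_near[OF eq XY(5,6)[of j]] far R unfolding L' by auto
    qed
    have "energy L' < energy L"
      unfolding energy_def by (rule sum_strict_mono_ex1) (use energy_at i in blast)+
    with min[OF \<open>C L'\<close>] show False by simp
  qed
  have degrees: "degree Q (L s) i = d i" if s: "s < k" and i: "i < r" for s i
  proof (rule ccontr)
    assume "degree Q (L s) i \<noteq> d i"
    then consider "degree Q (L s) i < d i" | "d i < degree Q (L s) i" by linarith
    then show False
    proof cases
      case 1
      have "degree Q (L t) i \<le> d i" if "t < k" for t using near[OF that s i] 1 by linarith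
      then have "(\<Sum>t<k. degree Q (L t) i) < (\<Sum>t<k. d i)"
        using s 1 by (intro sum_strict_mono_ex1) auto
      then show False using total[OF i] by simp
    next
      case 2
      have "d i \<le> degree Q (L t) i" if "t < k" for t using near[OF s that i] 2 by linarith
      then have "(\<Sum>t<k. d i) < (\<Sum>t<k. degree Q (L t) i)"
        using s 2 by (intro sum_strict_mono_ex1) auto
      then show False using total[OF i] by simp
    qed
  qed
  show thesis
    by (rule that[of L]) (intro conjI L1 L2 degrees; assumption)+
qed

section \<open>Patterns as families of columns\<close>

text \<open>The parts of the partition conjugate to \<open>x\<close>, with columns counted from 0.\<close>

definition height :: "nat list \<Rightarrow> nat \<Rightarrow> nat" where
  "height x t = card {j. j < length x \<and> t < x ! j}"

definition row_of_heights :: "nat \<Rightarrow> nat \<Rightarrow> (nat \<Rightarrow> nat) \<Rightarrow> nat list" where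
  "row_of_heights n T H = map (\<lambda>j. card {t. t < T \<and> j < H t}) [0..<n]"

lemma height_le_length: "height x t \<le> length x"
proof -
  have "height x t \<le> card {..<length x}" unfolding height_def by (rule card_mono) auto
  then show ?thesis by simp
qed

lemma less_height_iff:
  assumes "sorted_wrt (\<ge>) x" and j: "j < length x"
  shows "j < height x t \<longleftrightarrow> t < x ! j"
proof
  have mono: "x ! b \<le> x ! a" if "a \<le> b" "b < length x" for a b
    using assms(1) that by (cases "a = b") (auto simp: sorted_wrt_iff_nth_less)
  show "t < x ! j" if "j < height x t"
  proof (rule ccontr)
    assume "\<not> t < x ! j"
    have "i < j" if "i < length x" "t < x ! i" for i
    proof (rule ccontr)
      assume "\<not> i < j"
      with mono[of j i] that \<open>\<not> t < x ! j\<close> show False by simp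
    qed
    then have "{i. i < length x \<and> t < x ! i} \<subseteq> {..<j}" by blast
    from card_mono[OF _ this] show False using that by (simp add: height_def)
  qed
  show "j < height x t" if "t < x ! j"
  proof -
    have "{..j} \<subseteq> {i. i < length x \<and> t < x ! i}"
      using mono[of _ j] j that by (auto intro: less_le_trans)
    from card_mono[OF _ this] show ?thesis by (simp add: height_def)
  qed
qed

lemma card_less_height:
  assumes "sorted_wrt (\<ge>) x" "j < length x" "x ! j \<le> T"
  shows "card {t. t < T \<and> j < height x t} = x ! j"
proof -
  have "{t. t < T \<and> j < height x t} = {..<x ! j}"
    using assms by (auto simp: less_height_iff)
  then show ?thesis by simp
qed

lemma row_of_heights_height:
  assumes "sorted_wrt (\<ge>) x" "length x = n" "\<And>j. j < n \<Longrightarrow> x ! j \<le> T"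
  shows "row_of_heights n T (height x) = x"
  using assms by (intro nth_equalityI) (simp_all add: row_of_heights_def card_less_height)

text \<open>
  Double counting of the boxes of the diagram. The bound on the heights says that no box is cut off
  by the restriction to \<open>n\<close> entries.
\<close>

lemma sum_list_row_of_heights:
  assumes "\<And>t. t < T \<Longrightarrow> H t \<le> n"
  shows "sum_list (row_of_heights n T H) = (\<Sum>t<T. H t)"
proof -
  have "sum_list (row_of_heights n T H) = (\<Sum>j<n. card {t. t < T \<and> j < H t})"
    by (simp add: row_of_heights_def sum_list_sum_nth atLeast0LessThan)
  also have "\<dots> = (\<Sum>j<n. \<Sum>t<T. of_bool (j < H t))" by (simp add: Int_def)
  also have "\<dots> = (\<Sum>t<T. \<Sum>j<n. of_bool (j < H t))" by (rule sum.swap)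
  also have "\<dots> = (\<Sum>t<T. H t)"
  proof (rule sum.cong[OF refl])
    fix t assume "t \<in> {..<T}"
    then have "{..<n} \<inter> {j. j < H t} = {..<H t}" using assms[of t] by auto
    then show "(\<Sum>j<n. of_bool (j < H t)) = H t" by simp
  qed
  finally show ?thesis .
qed

lemma sum_lessThan_blocks:
  fixes f :: "nat \<Rightarrow> 'a::comm_monoid_add"
  shows "(\<Sum>t<Q * k. f t) = (\<Sum>q<Q. \<Sum>s<k. f (q * k + s))"
proof (induction Q)
  case (Suc Q)
  have "(\<Sum>t<a + b. f t) = (\<Sum>t<a. f t) + (\<Sum>s<b. f (a + s))" for a b
    by (induction b) (simp_all add: ac_simps)
  from this[of "Q * k" k] Suc.IH show ?case by (simp add: add.commute[of k])
qed simp

text \<open>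
  Multiplying a row by \<open>k\<close> replaces each of its columns by a block of \<open>k\<close> equal columns.
\<close>

lemma height_scale:
  assumes "s < k"
  shows "height (scale k y) (q * k + s) = height y q"
proof -
  have iff: "q * k + s < k * c \<longleftrightarrow> q < c" for c
  proof
    show "q < c" if "q * k + s < k * c"
    proof (rule ccontr)
      assume "\<not> q < c"
      then have "c * k \<le> q * k" by simp
      with that show False unfolding mult.commute[of k c] by linarith
    qed
    show "q * k + s < k * c" if "q < c"
    proof -
      have "Suc q * k \<le> c * k" using that by (intro mult_le_mono1) simp
      with assms show ?thesis by (simp add: mult.commute[of k c])
    qed
  qed
  have "j < length y \<and> q * k + s < scale k y ! j \<longleftrightarrow> j < length y \<and> q < y ! j" for j
    using iff[of "y ! j"] by (cases "j < length y") (simp_all only: scale_def nth_map simp_thms)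
  then show ?thesis by (simp only: height_def scale_def length_map)
qed

text \<open>
  The interlacing conditions say that the skew shape between the two rows is a horizontal strip,
  which has at most one box in each column.
\<close>

lemma height_skew_step:
  assumes "length x = n" "length y = n"
    and "\<And>j. j < n \<Longrightarrow> x ! j \<le> y ! j" and "\<And>j. j + 1 < n \<Longrightarrow> y ! (j + 1) \<le> x ! j"
  shows "height x t \<le> height y t" "height y t \<le> height x t + 1"
proof -
  show "height x t \<le> height y t"
    unfolding height_def by (rule card_mono) (use assms in \<open>auto intro: less_le_trans\<close>)
  have "{j. j < n \<and> t < y ! j} \<subseteq> insert 0 (Suc ` {j. j < n \<and> t < x ! j})"
  proof
    fix j assume j: "j \<in> {j. j < n \<and> t < y ! j}"
    show "j \<in> insert 0 (Suc ` {j. j < n \<and> t < x ! j})"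
    proof (cases j)
      case (Suc i)
      with j assms(4)[of i] have "i < n \<and> t < x ! i" by auto
      with Suc show ?thesis by blast
    qed simp
  qed
  from card_mono[OF _ this] have "height y t \<le> card (insert 0 (Suc ` {j. j < n \<and> t < x ! j}))"
    using assms(2) by (simp add: height_def)
  also have "\<dots> \<le> height x t + 1"
    using assms(1) by (simp add: height_def card_insert_if card_image)
  finally show "height y t \<le> height x t + 1" .
qed

lemma skew_GT_rows_sorted:
  assumes G: "skew_GT_pattern m n G" and bottom: "sorted_wrt (\<ge>) (G ! 0)" and i: "i < m"
  shows "sorted_wrt (\<ge>) (G ! i)"
proof (cases i)
  case (Suc l)
  have len: "length (G ! i) = n" using G i by (simp add: skew_GT_pattern_def)
  have "G ! i ! Suc j \<le> G ! i ! j" if "Suc j < n" for j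
  proof -
    have "G ! i ! Suc j \<le> G ! l ! j" "G ! l ! j \<le> G ! i ! j"
      using G i Suc that by (auto simp: skew_GT_pattern_def)
    then show ?thesis by simp
  qed
  then show ?thesis
    by (subst sorted_wrt_iff_nth_Suc_transp) (auto simp: len intro: transpI)
qed (use bottom in simp)

lemma skew_GT_column_mono:
  assumes G: "skew_GT_pattern m n G" and "i \<le> l" "l < m" "j < n"
  shows "G ! i ! j \<le> G ! l ! j"
  using assms(2,3)
proof (induction l rule: dec_induct)
  case (step l)
  then have "G ! l ! j \<le> G ! Suc l ! j" using G assms(4) by (auto simp: skew_GT_pattern_def)
  with step show ?case by simp
qed simp

text \<open>
  The heights of the columns may come in any order: counting the columns that exceed \<open>j\<close> sorts
  them, and sorting preserves steps of size 0 or 1. This is what allows the columns of different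
  blocks to be recombined freely.
\<close>

lemma skew_GT_row_of_heights:
  assumes "\<And>i t. i + 1 < m \<Longrightarrow> t < T \<Longrightarrow> H i t \<le> H (i + 1) t \<and> H (i + 1) t \<le> H i t + 1"
  shows "skew_GT_pattern m n (map (\<lambda>i. row_of_heights n T (H i)) [0..<m])"
  unfolding skew_GT_pattern_def
proof (intro conjI allI impI)
  fix i j assume *: "i + 1 < m \<and> j < n"
  have "card {t. t < T \<and> j < H i t} \<le> card {t. t < T \<and> j < H (i + 1) t}"
    by (rule card_mono) (use assms * in \<open>auto intro: less_le_trans\<close>)
  then show "map (\<lambda>i. row_of_heights n T (H i)) [0..<m] ! i ! j
      \<le> map (\<lambda>i. row_of_heights n T (H i)) [0..<m] ! (i + 1) ! j"
    using * by (simp add: row_of_heights_def)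
next
  fix i j assume *: "i + 1 < m \<and> j + 1 < n"
  have "card {t. t < T \<and> j + 1 < H (i + 1) t} \<le> card {t. t < T \<and> j < H i t}"
    by (rule card_mono) (use assms * in fastforce)+
  then show "map (\<lambda>i. row_of_heights n T (H i)) [0..<m] ! (i + 1) ! (j + 1)
      \<le> map (\<lambda>i. row_of_heights n T (H i)) [0..<m] ! i ! j"
    using * by (simp add: row_of_heights_def)
qed (simp_all add: row_of_heights_def)

lemma card_Int_lessThan_Suc: "card (A \<inter> {..<Suc i}) = card (A \<inter> {..<i}) + of_bool (i \<in> A)"
  by (cases "i \<in> A") (simp_all add: lessThan_Suc Int_insert_right)

text \<open>
  If all the columns of a block grow at a step, or none does, then the same must hold after
  rebalancing, since their number is preserved.
\<close>

lemma sum_of_bool_constant_iff: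
  assumes "(\<Sum>s<k. of_bool (A s)) = (\<Sum>s<k. of_bool B :: nat)" and s: "s < (k::nat)"
  shows "A s \<longleftrightarrow> B"
proof (cases B)
  case True
  have "\<not> (\<Sum>s<k. of_bool (A s)) < (\<Sum>s<k. 1 :: nat)" using assms(1) True by (simp del: sum_of_bool_eq)
  moreover have "(\<Sum>s<k. of_bool (A s)) < (\<Sum>s<k. 1 :: nat)" if "\<not> A s"
    by (rule sum_strict_mono_ex1) (use s that in auto)
  ultimately show ?thesis using True by blast
next
  case False
  then have "(\<Sum>s<k. of_bool (A s)) = (0 :: nat)" using assms(1) by (simp del: sum_of_bool_eq)
  then have "of_bool (A s) = (0 :: nat)" using s by (simp del: sum_of_bool_eq)
  with False show ?thesis by simp
qed

section \<open>Splitting a pattern into layers\<close>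

text \<open>
  The decomposition into layers. Here \<open>S s q\<close> is the set of steps at which the column with index
  \<open>s\<close> of block \<open>q\<close> grows, and \<open>L\<close> is a rebalancing of \<open>S\<close>; the layer \<open>P s\<close> has the column heights
  \<open>K s i q\<close> that result from growing at the steps in \<open>L s q\<close>.

  Row \<open>r\<close> of \<open>G\<close> is the sum of the rows \<open>r\<close> of the layers as soon as the rows below it consist of
  multiples of \<open>k\<close>: then all columns of block \<open>q\<close> have the same height in row \<open>r - 1\<close>, and the
  multiset of their heights in row \<open>r\<close> is determined by how many of them grow, a number on which
  \<open>L\<close> and \<open>S\<close> agree. For \<open>r = 0\<close> both sides come from the bottom row.
\<close>

lemma GT_layers:
  assumes k: "k \<ge> 1" and m: "m \<ge> 1"
    and lam: "padded_partition n lam" and mu: "padded_partition n mu" and nu: "length nu = m - 1"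
    and G: "G \<in> GT m n (scale k lam) (scale k mu) (scale k nu)"
  obtains P where
    "\<And>s. s < k \<Longrightarrow> P s \<in> GT m n lam mu nu"
    "\<And>r j. r < m \<Longrightarrow> (\<And>i l. i < r \<Longrightarrow> l < n \<Longrightarrow> k dvd G ! i ! l) \<Longrightarrow> j < n \<Longrightarrow>
       (\<Sum>s<k. P s ! r ! j) = G ! r ! j"
    "\<And>s r i j. s < k \<Longrightarrow> r < m \<Longrightarrow> (\<And>i l. i < r \<Longrightarrow> l < n \<Longrightarrow> k dvd G ! i ! l) \<Longrightarrow>
       i < r \<Longrightarrow> j < n \<Longrightarrow> k * P s ! i ! j = G ! i ! j"
proof -
  have GT: "skew_GT_pattern m n G" and top: "G ! (m - 1) = scale k lam" and bot: "G ! 0 = scale k mu"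
    and weight: "\<And>i. i < m - 1 \<Longrightarrow>
        int (sum_list (G ! (i + 1))) - int (sum_list (G ! i)) = int (scale k nu ! i)"
    using G by (auto simp: GT_def)
  have top': "G ! (m - Suc 0) = scale k lam" using top by simp
  have len: "length (G ! i) = n" if "i < m" for i using GT that by (simp add: skew_GT_pattern_def)
  have lenlm: "length lam = n" "length mu = n" using lam mu by (simp_all add: padded_partition_def)
  have sorted_lm: "sorted_wrt (\<ge>) lam" "sorted_wrt (\<ge>) mu"
    using lam mu by (simp_all add: padded_partition_def)
  have "sorted_wrt (\<ge>) (scale k mu)"
    unfolding scale_def sorted_wrt_map
    by (rule sorted_wrt_mono_rel[OF _ sorted_lm(2)]) simp
  then have sorted: "sorted_wrt (\<ge>) (G ! i)" if "i < m" for i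
    using skew_GT_rows_sorted[OF GT _ that] bot by simp
  \<comment> \<open>a bound on the entries of \<open>lam\<close>, so that all further columns are empty\<close>
  define Q where "Q = sum_list lam"
  have lamQ: "lam ! j \<le> Q" if "j < n" for j
    unfolding Q_def using that lenlm by (intro member_le_sum_list) auto
  have bound: "G ! i ! j \<le> Q * k" if "i < m" "j < n" for i j
  proof -
    have "G ! i ! j \<le> G ! (m - 1) ! j"
      by (rule skew_GT_column_mono[OF GT]) (use that in auto)
    also have "\<dots> = k * lam ! j" using that lenlm by (simp add: top' scale_def)
    also have "\<dots> \<le> k * Q" using lamQ[OF that(2)] by simp
    finally show ?thesis by (simp only: mult.commute)
  qed
  have "mu ! j \<le> lam ! j" if "j < n" for j
  proof -
    have "G ! 0 ! j \<le> G ! (m - 1) ! j"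
      by (rule skew_GT_column_mono[OF GT]) (use that m in auto)
    then have "k * mu ! j \<le> k * lam ! j" using that lenlm by (simp add: top' bot scale_def)
    then show ?thesis using k by simp
  qed
  then have muQ: "mu ! j \<le> Q" if "j < n" for j using lamQ that le_trans by blast

  define H where "H i = height (G ! i)" for i
  define S where "S s q = {i. i < m - 1 \<and> H (i + 1) (q * k + s) = H i (q * k + s) + 1}" for s q
  have H_step: "H (i + 1) (q * k + s) = H i (q * k + s) + of_bool (i \<in> S s q)" if "i < m - 1" for i q s
  proof -
    have "H i (q * k + s) \<le> H (i + 1) (q * k + s)" "H (i + 1) (q * k + s) \<le> H i (q * k + s) + 1"
      unfolding H_def
      by (rule height_skew_step[of _ n]; use GT that in \<open>auto simp: skew_GT_pattern_def\<close>)+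
    then show ?thesis using that by (auto simp: S_def)
  qed
  have H_0: "H 0 (q * k + s) = height mu q" if "s < k" for q s
    using height_scale[OF that] by (simp add: H_def bot)
  have H_top: "H (m - 1) (q * k + s) = height lam q" if "s < k" for q s
    using height_scale[OF that] by (simp only: H_def top)
  have H_eq: "H i (q * k + s) = height mu q + card (S s q \<inter> {..<i})" if "i \<le> m - 1" "s < k" for i q s
    using that(1)
  proof (induction i)
    case 0
    then show ?case using H_0[OF that(2)] by simp
  next
    case (Suc i)
    then have "H (Suc i) (q * k + s) = H i (q * k + s) + of_bool (i \<in> S s q)"
      using H_step[of i q s] by simp
    then show ?case using Suc by (simp add: card_Int_lessThan_Suc)
  qed
  have S_sub: "S s q \<subseteq> {..<m - 1}" for s q by (auto simp: S_def)
  have height_top: "height lam q = height mu q + card (S s q)" if "s < k" for s q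
    using H_eq[of "m - 1" s q] H_top[OF that, of q] that S_sub[of s q] by (simp add: Int_absorb2)
  have entry_heights: "G ! i ! j = (\<Sum>q<Q. \<Sum>s<k. of_bool (j < H i (q * k + s)))" if "i < m" "j < n" for i j
  proof -
    have "G ! i ! j = card {t. t < Q * k \<and> j < H i t}"
      unfolding H_def using card_less_height[OF sorted[OF that(1)]] len that bound by simp
    also have "\<dots> = (\<Sum>t<Q * k. of_bool (j < H i t))" by (simp add: Int_def)
    finally show ?thesis by (simp only: sum_lessThan_blocks)
  qed
  have row_sum: "sum_list (G ! i) = (\<Sum>q<Q. \<Sum>s<k. H i (q * k + s))" if "i < m" for i
  proof -
    have "sum_list (G ! i) = sum_list (row_of_heights n (Q * k) (H i))"
      unfolding H_def using row_of_heights_height[OF sorted[OF that] len[OF that]] bound that by simp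
    also have "\<dots> = (\<Sum>t<Q * k. H i t)"
      using height_le_length[of "G ! i"] len[OF that] by (intro sum_list_row_of_heights) (simp add: H_def)
    finally show ?thesis by (simp only: sum_lessThan_blocks)
  qed
  have degree_sum: "(\<Sum>s<k. degree Q (S s) i) = k * nu ! i" if i: "i < m - 1" for i
  proof -
    have "sum_list (G ! (i + 1)) = (\<Sum>q<Q. \<Sum>s<k. H (i + 1) (q * k + s))"
      by (rule row_sum) (use i in simp)
    also have "\<dots> = (\<Sum>q<Q. \<Sum>s<k. H i (q * k + s)) + (\<Sum>q<Q. \<Sum>s<k. of_bool (i \<in> S s q))"
      by (simp only: H_step[OF i] sum.distrib)
    also have "(\<Sum>q<Q. \<Sum>s<k. H i (q * k + s)) = sum_list (G ! i)"
      by (rule row_sum[symmetric]) (use i in simp)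
    finally have heights: "sum_list (G ! (i + 1)) =
      sum_list (G ! i) + (\<Sum>q<Q. \<Sum>s<k. of_bool (i \<in> S s q))" .
    have "scale k nu ! i = k * nu ! i" using i nu by (simp add: scale_def)
    then have "(\<Sum>q<Q. \<Sum>s<k. of_bool (i \<in> S s q)) = k * nu ! i"
      using weight[OF i] heights by linarith
    then show ?thesis
      unfolding degree_eq_sum by (subst sum.swap)
  qed
  obtain L where L: "\<And>s q. s < k \<Longrightarrow> q < Q \<Longrightarrow> L s q \<subseteq> {..<m - 1} \<and> card (L s q) = height lam q - height mu q"
    and L_count: "\<And>q i. q < Q \<Longrightarrow> (\<Sum>s<k. of_bool (i \<in> L s q)) = (\<Sum>s<k. of_bool (i \<in> S s q) :: nat)"
    and L_degree: "\<And>s i. s < k \<Longrightarrow> i < m - 1 \<Longrightarrow> degree Q (L s) i = nu ! i"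
  proof (rule balanced_layers[of k Q S "m - 1" "\<lambda>q. height lam q - height mu q" "\<lambda>i. nu ! i"])
    show "S s q \<subseteq> {..<m - 1} \<and> card (S s q) = height lam q - height mu q" if "s < k" for s q
      using S_sub height_top[OF that, of q] by simp
  qed (use degree_sum in blast)+

  define K where "K s i q = height mu q + card (L s q \<inter> {..<i})" for s i q
  define P where "P s = map (\<lambda>i. row_of_heights n Q (K s i)) [0..<m]" for s
  have K_step: "K s (i + 1) q = K s i q + of_bool (i \<in> L s q)" for s i q
    by (simp add: K_def card_Int_lessThan_Suc)
  have K_top: "K s (m - 1) q = height lam q" if "s < k" "q < Q" for s q
    using L[OF that] height_top[OF that(1), of q] by (simp add: K_def Int_absorb2)
  have K_le: "K s i q \<le> n" if "s < k" "q < Q" "i < m" for s i q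
  proof -
    have "K s i q \<le> K s (m - 1) q"
      unfolding K_def using that(3) by (intro add_left_mono card_mono) auto
    then show ?thesis using K_top[OF that(1,2)] height_le_length[of lam q] lenlm by simp
  qed
  have P_row: "P s ! i = row_of_heights n Q (K s i)" if "i < m" for s i
    using that by (simp add: P_def)
  have row_cong: "row_of_heights n Q f = row_of_heights n Q g" if "\<And>q. q < Q \<Longrightarrow> f q = g q" for f g
    using that unfolding row_of_heights_def by (intro map_cong refl arg_cong[where f = card]) auto
  have P_GT: "P s \<in> GT m n lam mu nu" if s: "s < k" for s
  proof -
    have "skew_GT_pattern m n (P s)"
      unfolding P_def by (rule skew_GT_row_of_heights) (simp add: K_step[simplified])
    moreover have "P s ! (m - 1) = lam"
    proof -
      have "P s ! (m - 1) = row_of_heights n Q (height lam)"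
        using m K_top[OF s] by (simp add: P_row) (rule row_cong, simp)
      then show ?thesis using row_of_heights_height[OF sorted_lm(1) lenlm(1) lamQ] by simp
    qed
    moreover have "P s ! 0 = mu"
    proof -
      have "P s ! 0 = row_of_heights n Q (height mu)"
        using m by (simp add: P_row) (rule row_cong, simp add: K_def)
      then show ?thesis using row_of_heights_height[OF sorted_lm(2) lenlm(2) muQ] by simp
    qed
    moreover have "int (sum_list (P s ! (i + 1))) - int (sum_list (P s ! i)) = int (nu ! i)" if i: "i < m - 1" for i
    proof -
      have sums: "sum_list (P s ! l) = (\<Sum>q<Q. K s l q)" if "l < m" for l
        using K_le[OF s] that by (simp add: P_row sum_list_row_of_heights)
      have "sum_list (P s ! (i + 1)) = (\<Sum>q<Q. K s (i + 1) q)" by (rule sums) (use i in simp)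
      also have "\<dots> = (\<Sum>q<Q. K s i q) + (\<Sum>q<Q. of_bool (i \<in> L s q))"
        by (simp only: K_step sum.distrib)
      also have "(\<Sum>q<Q. K s i q) = sum_list (P s ! i)" by (rule sums[symmetric]) (use i in simp)
      also have "(\<Sum>q<Q. of_bool (i \<in> L s q)) = nu ! i"
        using L_degree[OF s i] by (simp only: degree_eq_sum)
      finally show ?thesis by simp
    qed
    ultimately show ?thesis by (simp add: GT_def)
  qed
  have P_entry: "P s ! i ! j = (\<Sum>q<Q. of_bool (j < K s i q))" if "i < m" "j < n" for s i j
    using that by (simp add: P_row row_of_heights_def Int_def)

  have below: "K s i q = H i (q * k + t) \<and> (\<Sum>u<k. of_bool (i \<in> L u q)) = (\<Sum>u<k. of_bool (i \<in> S u q) :: nat)"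
    if r: "r < m" and dvd: "\<And>i l. i < r \<Longrightarrow> l < n \<Longrightarrow> k dvd G ! i ! l" and "i < r" "s < k" "t < k" "q < Q"
    for r i s t q
  proof -
    \<comment> \<open>rows below \<open>r\<close> are multiples of \<open>k\<close>, so the columns of a block agree there\<close>
    have same: "H l (q * k + s) = H l (q * k + t)" if "l < r" "s < k" "t < k" for l s t
    proof -
      define y where "y = map (\<lambda>c. c div k) (G ! l)"
      have "G ! l = scale k y"
        using len[of l] r that(1) dvd[OF that(1)] by (intro nth_equalityI) (auto simp: y_def scale_def)
      then show ?thesis using height_scale[OF that(2)] height_scale[OF that(3)] by (simp add: H_def)
    qed
    have "L s q \<inter> {..<i} = S t q \<inter> {..<i}"
    proof -
      have "l \<in> L s q \<longleftrightarrow> l \<in> S t q" if "l < i" for l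
      proof -
        have "l \<in> S u q \<longleftrightarrow> l \<in> S t q" if "u < k" for u
          using same[of l u t] same[of "l + 1" u t] that \<open>l < i\<close> \<open>i < r\<close> \<open>t < k\<close> by (simp add: S_def)
        then have "(\<Sum>u<k. of_bool (l \<in> L u q)) = (\<Sum>u<k. of_bool (l \<in> S t q) :: nat)"
          unfolding L_count[OF \<open>q < Q\<close>] by (intro sum.cong) auto
        from sum_of_bool_constant_iff[OF this \<open>s < k\<close>] show ?thesis .
      qed
      then show ?thesis by auto
    qed
    then show ?thesis
      using H_eq[of i t q] r \<open>i < r\<close> \<open>t < k\<close> L_count[OF \<open>q < Q\<close>] by (simp add: K_def del: sum_of_bool_eq)
  qed
  show thesis
  proof (rule that[of P])
    show "P s \<in> GT m n lam mu nu" if "s < k" for s using that by (rule P_GT)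
  next
    fix r j assume r: "r < m" and dvd: "\<And>i l. i < r \<Longrightarrow> l < n \<Longrightarrow> k dvd G ! i ! l" and j: "j < n"
    have inner: "(\<Sum>s<k. of_bool (j < K s r q)) = (\<Sum>s<k. of_bool (j < H r (q * k + s)) :: nat)" if q: "q < Q" for q
    proof (cases r)
      case 0
      then show ?thesis using H_0 by (intro sum.cong) (auto simp: K_def)
    next
      case (Suc i)
      \<comment> \<open>the common height of all columns of block \<open>q\<close> in row \<open>r - 1\<close>\<close>
      define c where "c = H i (q * k + 0)"
      have K: "K s r q = c + of_bool (i \<in> L s q)" if "s < k" for s
        using below[OF r dvd, of i s 0 q] Suc that q k K_step[of s i q] by (simp add: c_def)
      have H: "H r (q * k + s) = c + of_bool (i \<in> S s q)" if "s < k" for s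
        using below[OF r dvd, of i s s q] below[OF r dvd, of i s 0 q] Suc that q k H_step[of i q s] r
        by (simp add: c_def)
      have split: "of_bool (j < c + of_bool b) = (of_bool (j < c) + of_bool (j = c) * of_bool b :: nat)" for b
        by auto
      have "(\<Sum>s<k. of_bool (j < K s r q)) =
          (\<Sum>s<k. of_bool (j < c)) + of_bool (j = c) * (\<Sum>s<k. of_bool (i \<in> L s q) :: nat)"
        by (simp add: K split sum.distrib sum_distrib_left del: sum_of_bool_eq sum_constant)
      also have "\<dots> = (\<Sum>s<k. of_bool (j < H r (q * k + s)))"
        unfolding L_count[OF q]
        by (simp add: H split sum.distrib sum_distrib_left del: sum_of_bool_eq sum_constant)
      finally show ?thesis .
    qed
    have "(\<Sum>q<Q. \<Sum>s<k. of_bool (j < K s r q)) = (\<Sum>q<Q. \<Sum>s<k. of_bool (j < H r (q * k + s)) :: nat)"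
      by (rule sum.cong[OF refl], rule inner) simp
    moreover have "(\<Sum>s<k. P s ! r ! j) = (\<Sum>q<Q. \<Sum>s<k. of_bool (j < K s r q))"
      by (simp only: P_entry[OF r j]) (rule sum.swap)
    ultimately show "(\<Sum>s<k. P s ! r ! j) = G ! r ! j" by (simp only: entry_heights[OF r j])
  next
    fix s r i j assume s: "s < k" and r: "r < m" and dvd: "\<And>i l. i < r \<Longrightarrow> l < n \<Longrightarrow> k dvd G ! i ! l"
      and i: "i < r" and j: "j < n"
    have im: "i < m" using i r by simp
    have "G ! i ! j = (\<Sum>q<Q. \<Sum>t<k. of_bool (j < K s i q))"
      unfolding entry_heights[OF im j] using below[OF r dvd i s] by (intro sum.cong) auto
    also have "\<dots> = k * P s ! i ! j"
      by (simp add: P_entry[OF im j] sum_distrib_left del: sum_of_bool_eq)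
    finally show "k * P s ! i ! j = G ! i ! j" by simp
  qed
qed

section \<open>The lexicographic order on patterns\<close>

lemma finite_GT:
  assumes m: "m \<ge> 1"
  shows "finite (GT m n lam mu nu)"
proof -
  let ?R = "{xs. set xs \<subseteq> {..sum_list lam} \<and> length xs = n}"
  have "GT m n lam mu nu \<subseteq> {G. set G \<subseteq> ?R \<and> length G = m}"
  proof
    fix G assume "G \<in> GT m n lam mu nu"
    then have G: "skew_GT_pattern m n G" and top: "G ! (m - 1) = lam" by (simp_all add: GT_def)
    have len: "length G = m" "\<And>i. i < m \<Longrightarrow> length (G ! i) = n"
      using G by (simp_all add: skew_GT_pattern_def)
    have "G ! i ! j \<le> sum_list lam" if "i < m" "j < n" for i j
    proof -
      have "G ! i ! j \<le> G ! (m - 1) ! j"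
        by (rule skew_GT_column_mono[OF G]) (use that in auto)
      also have "\<dots> = lam ! j" by (simp only: top)
      also have "\<dots> \<le> sum_list lam"
        using len(2)[of "m - 1"] m top that(2) by (intro member_le_sum_list) auto
      finally show ?thesis .
    qed
    then show "G \<in> {G. set G \<subseteq> ?R \<and> length G = m}"
      using len by (force simp: in_set_conv_nth)
  qed
  moreover have "finite {G. set G \<subseteq> ?R \<and> length G = m}"
    by (intro finite_lists_length_eq) simp
  ultimately show ?thesis by (rule finite_subset)
qed

lemma lex_less_trans: "lex_less F G \<Longrightarrow> lex_less G H \<Longrightarrow> lex_less F H"
  unfolding lex_less_def by (rule lexord_trans) (auto intro: trans_less_than)

lemma lex_less_irrefl: "\<not> lex_less G G"
  unfolding lex_less_def by (rule lexord_irreflexive) simp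

lemma lex_less_asym: "lex_less G H \<Longrightarrow> \<not> lex_less H G"
  using lex_less_trans lex_less_irrefl by blast

lemma lex_largestD: "lex_largest S G \<Longrightarrow> H \<in> S \<Longrightarrow> \<not> lex_less G H"
  unfolding lex_largest_def using lex_less_irrefl lex_less_asym by metis

lemma lex_smallestD: "lex_smallest S G \<Longrightarrow> H \<in> S \<Longrightarrow> \<not> lex_less H G"
  unfolding lex_smallest_def using lex_less_irrefl lex_less_asym by metis

lemma lex_less_linear:
  assumes "skew_GT_pattern m n G" "skew_GT_pattern m n H" "G \<noteq> H"
  shows "lex_less G H \<or> lex_less H G"
proof -
  have "\<forall>(x, y)\<in>set (zip G H). length x = length y"
    using assms(1,2) by (auto simp: skew_GT_pattern_def in_set_zip)
  then have "concat G \<noteq> concat H"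
    using assms by (simp add: concat_eq_concat_iff skew_GT_pattern_def)
  moreover have "(concat G, concat H) \<in> lexord less_than \<or> concat G = concat H \<or>
      (concat H, concat G) \<in> lexord less_than"
    by (rule lexord_linear) auto
  ultimately show ?thesis by (auto simp: lex_less_def)
qed

lemma ex1_lex_extremal:
  assumes "finite S" "S \<noteq> {}" "\<And>G. G \<in> S \<Longrightarrow> skew_GT_pattern m n G"
  shows "\<exists>!G. lex_largest S G" and "\<exists>!G. lex_smallest S G"
proof -
  have order: "asymp_on S lex_less" "transp_on S lex_less"
    by (auto intro!: asymp_onI transp_onI dest: lex_less_asym intro: lex_less_trans)
  have linear: "lex_less G H \<or> lex_less H G" if "G \<in> S" "H \<in> S" "G \<noteq> H" for G H
    using lex_less_linear[of m n] assms(3) that by blast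
  obtain M where "M \<in> S" "\<forall>G\<in>S. G \<noteq> M \<longrightarrow> \<not> lex_less M G"
    using Finite_Set.bex_max_element[OF assms(1) order assms(2)] by blast
  then have "lex_largest S M" using linear by (auto simp: lex_largest_def)
  then show "\<exists>!G. lex_largest S G"
  proof (rule ex1I)
    fix G assume "lex_largest S G"
    with \<open>lex_largest S M\<close> have "M \<noteq> G \<Longrightarrow> lex_less M G" "M \<noteq> G \<Longrightarrow> lex_less G M"
      by (simp_all add: lex_largest_def)
    with lex_less_asym show "G = M" by blast
  qed
  obtain M where "M \<in> S" "\<forall>G\<in>S. G \<noteq> M \<longrightarrow> \<not> lex_less G M"
    using Finite_Set.bex_min_element[OF assms(1) order assms(2)] by blast
  then have "lex_smallest S M" using linear by (auto simp: lex_smallest_def)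
  then show "\<exists>!G. lex_smallest S G"
  proof (rule ex1I)
    fix G assume "lex_smallest S G"
    with \<open>lex_smallest S M\<close> have "M \<noteq> G \<Longrightarrow> lex_less M G" "M \<noteq> G \<Longrightarrow> lex_less G M"
      by (simp_all add: lex_smallest_def)
    with lex_less_asym show "G = M" by blast
  qed
qed

lemma lex_less_first_difference:
  assumes G: "skew_GT_pattern m n G" and H: "skew_GT_pattern m n H" and i: "i < m" and j: "j < n"
    and rows: "\<And>l c. l < i \<Longrightarrow> c < n \<Longrightarrow> G ! l ! c = H ! l ! c"
    and row: "\<And>c. c < j \<Longrightarrow> G ! i ! c = H ! i ! c"
    and less: "G ! i ! j < H ! i ! j"
  shows "lex_less G H"
proof -
  have decomp: "concat F = (concat (take i F) @ take j (F ! i)) @ F ! i ! j #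
      (drop (Suc j) (F ! i) @ concat (drop (Suc i) F))" if F: "skew_GT_pattern m n F" for F
  proof -
    have len: "i < length F" "j < length (F ! i)" using F i j by (simp_all add: skew_GT_pattern_def)
    have "concat F = concat (take i F @ F ! i # drop (Suc i) F)"
      by (simp only: id_take_nth_drop[OF len(1), symmetric])
    also have "\<dots> = concat (take i F) @ F ! i @ concat (drop (Suc i) F)" by simp
    also have "F ! i = take j (F ! i) @ F ! i ! j # drop (Suc j) (F ! i)"
      by (rule id_take_nth_drop[OF len(2)])
    finally show ?thesis by (simp only: append_assoc append_Cons)
  qed
  have "take i G = take i H"
  proof (rule nth_take_lemma)
    show "l < i \<longrightarrow> G ! l = H ! l" for l
      using G H i rows by (intro impI nth_equalityI) (auto simp: skew_GT_pattern_def)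
  qed (use G H i in \<open>simp_all add: skew_GT_pattern_def\<close>)
  moreover have "take j (G ! i) = take j (H ! i)"
    by (rule nth_take_lemma) (use G H i j row in \<open>simp_all add: skew_GT_pattern_def\<close>)
  ultimately have "concat G = (concat (take i H) @ take j (H ! i)) @ G ! i ! j #
      (drop (Suc j) (G ! i) @ concat (drop (Suc i) G))"
    using decomp[OF G] by simp
  with decomp[OF H] less show ?thesis
    unfolding lex_less_def lexord_def by blast
qed

section \<open>Extremal patterns\<close>

lemma scale_GT:
  assumes m: "m \<ge> 1" and nu: "length nu = m - 1" and P: "P \<in> GT m n lam mu nu"
  shows "map (scale k) P \<in> GT m n (scale k lam) (scale k mu) (scale k nu)"
proof -
  have pat: "skew_GT_pattern m n P" and ends: "P ! (m - 1) = lam" "P ! 0 = mu"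
    and weight: "\<And>i. i < m - 1 \<Longrightarrow> int (sum_list (P ! (i + 1))) - int (sum_list (P ! i)) = int (nu ! i)"
    using P by (simp_all add: GT_def)
  have len: "length P = m" "\<And>i. i < m \<Longrightarrow> length (P ! i) = n"
    using pat by (simp_all add: skew_GT_pattern_def)
  have sum: "sum_list (scale k x) = k * sum_list x" for x
    by (simp add: scale_def sum_list_const_mult)
  have "skew_GT_pattern m n (map (scale k) P)"
    using pat by (auto simp: skew_GT_pattern_def scale_def)
  moreover have "int (sum_list (map (scale k) P ! (i + 1))) - int (sum_list (map (scale k) P ! i))
      = int (scale k nu ! i)" if "i < m - 1" for i
  proof -
    have "int (sum_list (P ! (i + 1))) = int (sum_list (P ! i)) + int (nu ! i)"
      using weight[OF that] by simp
    then show ?thesis using that len nu by (simp add: sum) (simp add: scale_def distrib_left)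
  qed
  moreover have "map (scale k) P ! (m - 1) = scale k lam" "map (scale k) P ! 0 = scale k mu"
    using m len ends by auto
  ultimately show ?thesis by (simp add: GT_def)
qed

lemma ex_below_and_above_average:
  fixes f :: "nat \<Rightarrow> nat"
  assumes "(\<Sum>s<k. f s) = k * c" and "s < k" "f s \<noteq> c"
  shows "\<exists>s<k. f s < c" and "\<exists>s<k. c < f s"
proof -
  show "\<exists>s<k. f s < c"
  proof (rule ccontr)
    assume "\<not> (\<exists>s<k. f s < c)"
    then have "\<forall>t\<in>{..<k}. c \<le> f t" by (meson lessThan_iff not_less)
    moreover from this have "\<exists>t\<in>{..<k}. c < f t" using assms(2,3) by (metis lessThan_iff le_neq_implies_less)
    ultimately have "(\<Sum>t<k. c) < (\<Sum>t<k. f t)" by (intro sum_strict_mono_ex1) simp_all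
    with assms(1) show False by simp
  qed
  show "\<exists>s<k. c < f s"
  proof (rule ccontr)
    assume "\<not> (\<exists>s<k. c < f s)"
    then have "\<forall>t\<in>{..<k}. f t \<le> c" by (meson lessThan_iff not_less)
    moreover from this have "\<exists>t\<in>{..<k}. f t < c" using assms(2,3) by (metis lessThan_iff le_neq_implies_less)
    ultimately have "(\<Sum>t<k. f t) < (\<Sum>t<k. c)" by (intro sum_strict_mono_ex1) simp_all
    with assms(1) show False by simp
  qed
qed

text \<open>
  In the lowest row \<open>r\<close> with a bad entry, \<open>G\<close> is the average of the patterns \<open>k P\<close> of
  \<open>GT_layers\<close>, but not equal to all of them, while the rows below agree. At the first column \<open>c\<close> where
  one of them differs from \<open>G\<close>, some exceed \<open>G\<close> and some stay below.
\<close>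

lemma not_multiple_not_lex_extremal:
  assumes k: "k \<ge> 1" and m: "m \<ge> 1"
    and lam: "padded_partition n lam" and mu: "padded_partition n mu" and nu: "length nu = m - 1"
    and G: "G \<in> GT m n (scale k lam) (scale k mu) (scale k nu)"
    and bad: "i < m" "j < n" "\<not> k dvd G ! i ! j"
  shows "\<exists>H\<in>GT m n (scale k lam) (scale k mu) (scale k nu). lex_less G H"
    and "\<exists>H\<in>GT m n (scale k lam) (scale k mu) (scale k nu). lex_less H G"
proof -
  obtain P where P_GT: "\<And>s. s < k \<Longrightarrow> P s \<in> GT m n lam mu nu"
    and P_sum: "\<And>r j. r < m \<Longrightarrow> (\<And>i l. i < r \<Longrightarrow> l < n \<Longrightarrow> k dvd G ! i ! l) \<Longrightarrow> j < n \<Longrightarrow>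
       (\<Sum>s<k. P s ! r ! j) = G ! r ! j"
    and P_below: "\<And>s r i j. s < k \<Longrightarrow> r < m \<Longrightarrow> (\<And>i l. i < r \<Longrightarrow> l < n \<Longrightarrow> k dvd G ! i ! l) \<Longrightarrow>
       i < r \<Longrightarrow> j < n \<Longrightarrow> k * P s ! i ! j = G ! i ! j"
    using GT_layers[OF k m lam mu nu G] by blast
  define r where "r = (LEAST i. i < m \<and> (\<exists>j<n. \<not> k dvd G ! i ! j))"
  have "r < m \<and> (\<exists>j<n. \<not> k dvd G ! r ! j)"
    unfolding r_def by (rule LeastI[of _ i]) (use bad in blast)
  then obtain j0 where r: "r < m" and j0: "j0 < n" "\<not> k dvd G ! r ! j0" by blast
  have dvd: "k dvd G ! i ! l" if "i < r" "l < n" for i l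
    using not_less_Least[OF that(1)[unfolded r_def]] that r by auto
  define c where "c = (LEAST c. c < n \<and> (\<exists>s<k. k * P s ! r ! c \<noteq> G ! r ! c))"
  have "c < n \<and> (\<exists>s<k. k * P s ! r ! c \<noteq> G ! r ! c)"
    unfolding c_def by (rule LeastI[of _ j0]) (use j0 k in \<open>metis One_nat_def Suc_le_lessD dvd_triv_left\<close>)
  then obtain s0 where c: "c < n" and s0: "s0 < k" "k * P s0 ! r ! c \<noteq> G ! r ! c" by blast
  have before: "k * P s ! r ! b = G ! r ! b" if "b < c" "s < k" for b s
    using not_less_Least[OF that(1)[unfolded c_def]] that c by auto
  have "(\<Sum>s<k. k * P s ! r ! c) = k * G ! r ! c"
    using P_sum[OF r dvd c] by (simp flip: sum_distrib_left)
  note extremes = ex_below_and_above_average[OF this s0]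
  have entry: "map (scale k) (P s) ! i ! j = k * P s ! i ! j" if "s < k" "i < m" "j < n" for s i j
    using P_GT[OF that(1)] that(2,3) by (simp add: GT_def skew_GT_pattern_def scale_def)
  have pat: "skew_GT_pattern m n (map (scale k) (P s))" if "s < k" for s
    using scale_GT[OF m nu P_GT[OF that], of k] by (simp add: GT_def)
  have G_pat: "skew_GT_pattern m n G" using G by (simp add: GT_def)
  have agree: "map (scale k) (P s) ! l ! b = G ! l ! b" if "s < k" "l < r" "b < n" for s l b
    using entry[of s l b] P_below[OF that(1) r dvd that(2,3)] that r by simp
  have agree': "map (scale k) (P s) ! r ! b = G ! r ! b" if "s < k" "b < c" for s b
    using entry[of s r b] before[OF that(2,1)] that r c by simp
  show "\<exists>H\<in>GT m n (scale k lam) (scale k mu) (scale k nu). lex_less G H"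
  proof -
    obtain s where s: "s < k" "G ! r ! c < k * P s ! r ! c" using extremes(2) by blast
    have "lex_less G (map (scale k) (P s))"
      by (rule lex_less_first_difference[OF G_pat pat[OF s(1)] r c])
        (use s entry[OF s(1) r c] agree[OF s(1)] agree'[OF s(1)] in simp_all)
    then show ?thesis using scale_GT[OF m nu P_GT[OF s(1)]] by blast
  qed
  show "\<exists>H\<in>GT m n (scale k lam) (scale k mu) (scale k nu). lex_less H G"
  proof -
    obtain s where s: "s < k" "k * P s ! r ! c < G ! r ! c" using extremes(1) by blast
    have "lex_less (map (scale k) (P s)) G"
      by (rule lex_less_first_difference[OF pat[OF s(1)] G_pat r c])
        (use s entry[OF s(1) r c] agree[OF s(1)] agree'[OF s(1)] in simp_all)
    then show ?thesis using scale_GT[OF m nu P_GT[OF s(1)]] by blast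
  qed
qed

lemma no_snakes_if_multiples:
  assumes "\<forall>p\<in>positions G. k dvd entry G p"
  shows "canonical_snake_partition k G = {}"
proof -
  have False if T: "T \<in> tiling G" and v: "entry G ` T = {v}" and "\<not> k dvd v" for T v
  proof -
    obtain p where "p \<in> T" "entry G p = v" using v by blast
    moreover have "T \<subseteq> positions G"
      using is_tiling_tiling[of G] T by (auto simp: is_tiling_def partition_on_def)
    ultimately show False using assms \<open>\<not> k dvd v\<close> by blast
  qed
  then show ?thesis by (auto simp: canonical_snake_partition_def free_tile_def)
qed

theorem corollary19:
  fixes k m n :: nat and lam mu nu :: "nat list"
  assumes "k \<ge> 1" and "m \<ge> 1"
    and "padded_partition n lam" and "padded_partition n mu" and "length nu = m - 1"
    and "GT m n (scale k lam) (scale k mu) (scale k nu) \<noteq> {}"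
  shows "(\<exists>!G. lex_largest (GT m n (scale k lam) (scale k mu) (scale k nu)) G) \<and>
    (\<forall>G. lex_largest (GT m n (scale k lam) (scale k mu) (scale k nu)) G \<longrightarrow>
       canonical_snake_partition k G = {} \<and> (\<forall>p\<in>positions G. k dvd entry G p)) \<and>
    (\<exists>!G. lex_smallest (GT m n (scale k lam) (scale k mu) (scale k nu)) G) \<and>
    (\<forall>G. lex_smallest (GT m n (scale k lam) (scale k mu) (scale k nu)) G \<longrightarrow>
       canonical_snake_partition k G = {} \<and> (\<forall>p\<in>positions G. k dvd entry G p))"
proof -
  let ?S = "GT m n (scale k lam) (scale k mu) (scale k nu)"
  have pat: "skew_GT_pattern m n G" if "G \<in> ?S" for G using that by (simp add: GT_def)
  have multiples: "canonical_snake_partition k G = {} \<and> (\<forall>p\<in>positions G. k dvd entry G p)"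
    if G: "G \<in> ?S" and extremal: "(\<forall>H\<in>?S. \<not> lex_less G H) \<or> (\<forall>H\<in>?S. \<not> lex_less H G)" for G
  proof -
    have "k dvd G ! i ! j" if "i < m" "j < n" for i j
      using not_multiple_not_lex_extremal[OF assms(1-5) G that] extremal by blast
    then have "\<forall>p\<in>positions G. k dvd entry G p"
      using pat[OF G] by (auto simp: positions_def entry_def skew_GT_pattern_def)
    with no_snakes_if_multiples show ?thesis by blast
  qed
  have "canonical_snake_partition k G = {} \<and> (\<forall>p\<in>positions G. k dvd entry G p)"
    if "lex_largest ?S G" for G
    by (rule multiples) (use that lex_largestD[OF that] in \<open>simp_all add: lex_largest_def\<close>)
  moreover have "canonical_snake_partition k G = {} \<and> (\<forall>p\<in>positions G. k dvd entry G p)"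
    if "lex_smallest ?S G" for G
    by (rule multiples) (use that lex_smallestD[OF that] in \<open>simp_all add: lex_smallest_def\<close>)
  moreover note ex1_lex_extremal[OF finite_GT[OF assms(2)] assms(6) pat]
  ultimately show ?thesis by (intro conjI allI impI) simp_all
qed

end
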